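(* Let $\mathbb F$ be an algebraically closed field and let $q\in\mathbb F$ be nonzero and not a root of unity. Let $a,b,c$ be nonzero scalars in $\mathbb F$ and $d\ge1$ an integer. Assume that $(a,b,c,d)$ is feasible, and define $t=abc^{-1}$. Then the following (i)--(iv) hold. (i) The pair $$ax_{01}+a^{-1}x_{12},\qquad bx_{23}+b^{-1}x_{30}$$ acts on the $\boxtimes_q$-module $\mathbf V_d(t)$ as a Leonard pair of $q$-Racah type. (ii) This Leonard pair corresponds to $(a,b,c,d)$. (iii) The element $\mathbf C=cx_{30}+c^{-1}x_{01}+ab^{-1}\frac{[x_{30},x_{01}]}{q-q^{-1}}$ of $\boxtimes_q$ acts on $\mathbf V_d(t)$ as the $\mathbb Z_3$-symmetric completion of this Leonard pair. (iv) The element $\mathbf C'=cx_{12}+c^{-1}x_{23}+ba^{-1}\frac{[x_{12},x_{23}]}{q-q^{-1}}$ of $\boxtimes_q$ acts on $\mathbf V_d(t)$ as the dual $\mathbb Z_3$-symmetric completion of this Leonard pair.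
   Context: Algebras are associative with 1. $[n]_q=(q^n-q^{-n})/(q-q^{-1})$, $\mathbb Z_4=\mathbb Z/4\mathbb Z$, and $[u,v]=uv-vu$. The $q$-tetrahedron algebra $\boxtimes_q$ is the $\mathbb F$-algebra with generators (called the standard generators) $\{x_{ij}\mid i,j\in\mathbb Z_4,\ j-i=1\text{ or }j-i=2\}$ and relations: (i) $x_{ij}x_{ji}=1$ if $j-i=2$; (ii) $\frac{qx_{ij}x_{jk}-q^{-1}x_{jk}x_{ij}}{q-q^{-1}}=1$ if $(j-i,k-j)$ is one of $(1,1),(1,2),(2,1)$; (iii) $x_{ij}^3x_{k\ell}-[3]_qx_{ij}^2x_{k\ell}x_{ij}+[3]_qx_{ij}x_{k\ell}x_{ij}^2-x_{k\ell}x_{ij}^3=0$ if $j-i=k-j=\ell-k=1$. Matrices in ${\rm Mat}_{d+1}(\mathbb F)$ have rows and columns indexed by $0,\dots,d$; $M$ represents $A$ with respect to a basis $\{v_n\}_{n=0}^d$ when $Av_n=\sum_i M_{in}v_i$. Entries not mentioned below are $0$. A subscript $q^{-1}$ means that $q$ is replaced by $q^{-1}$ in the definition (and similarly $t^{-1}$ as argument). - $Z$: $(i,j)$-entry $\delta_{i+j,d}$. - $K_q$: diagonal, $(i,i)$-entry $q^{d-2i}$. - $E_q$: $(i,i)$-entry $q^{2i-d}$; $(i-1,i)$-entry $q^d-q^{2i-2-d}$. - $G_q(t)$: $(i,i)$-entry $q^{2i-d}$; $(i-1,i)$-entry $(q^d-q^{2i-2-d})(1-tq^{d-2i+1})$.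 - $L_q(t)$: $(i,i)$-entry $q^{2i-d}$; $(i-1,i)$-entry $(q^d-q^{2i-2-d})(1-tq^{d-2i+1})^{-1}$. - $S_q(t)$: $(i-1,i)$-entry $(q^d-q^{2i-d-2})(1-tq^{2i-d-1})$; $(i,i-1)$-entry $(q^{2i-d}-q^{-d})q^{2i-d-1}t$; $(i,i)$-entry $q^d-(q^{2i-d}-q^{-d})q^{2i-d-1}t-(q^d-q^{2i-d})(1-tq^{2i-d+1})$. For an integer $d\ge1$ and a nonzero $t\in\mathbb F$ not among $\{q^{d-2n+1}\}_{n=1}^d$, $\mathbf V_d(t)$ is the $(d+1)$-dimensional $\boxtimes_q$-module having a basis with respect to which the standard generators are represented by: $x_{01}: ZS_{q^{-1}}(t^{-1})Z$, $x_{12}: E_q$, $x_{23}: K_q$, $x_{30}: ZG_{q^{-1}}(t)Z$, $x_{02}: L_q(t)$, $x_{13}: (ZE_{q^{-1}}Z)^{-1}$, $x_{20}: (L_q(t))^{-1}$, $x_{31}: ZE_{q^{-1}}Z$. Leonard pairs. A Leonard pair on a finite-dimensional nonzero $\mathbb F$-vector space $V$ is an ordered pair $A,B\in{\rm End}(V)$ such that there is a basis of $V$ in which $A$ is diagonal and $B$ is irreducible tridiagonal, and a basis in which $B$ is diagonal and $A$ is irreducible tridiagonal (irreducible: all subdiagonal and superdiagonal entries nonzero). $(a,b,c,d)$ is feasible when: (i) neither of $a^2,b^2$ is among $q^{2d-2},q^{2d-4},\dots,q^{2-2d}$; (ii) none of $abc,a^{-1}bc,ab^{-1}c,abc^{-1}$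 is among $q^{d-1},q^{d-3},\dots,q^{1-d}$. Put $\theta_n=aq^{2n-d}+a^{-1}q^{d-2n}$, $\theta^*_n=bq^{2n-d}+b^{-1}q^{d-2n}$ ($0\le n\le d$) and, for $1\le n\le d$, $\varphi_n=a^{-1}b^{-1}q^{d+1}(q^n-q^{-n})(q^{n-d-1}-q^{d-n+1})(q^{-n}-abcq^{n-d-1})(q^{-n}-abc^{-1}q^{n-d-1})$, $\phi_n=ab^{-1}q^{d+1}(q^n-q^{-n})(q^{n-d-1}-q^{d-n+1})(q^{-n}-a^{-1}bcq^{n-d-1})(q^{-n}-a^{-1}bc^{-1}q^{n-d-1})$. For feasible $(a,b,c,d)$ there is (known) a Leonard pair $A,B$, unique up to isomorphism (simultaneous conjugation by a linear bijection), such that: in one basis $A$ is lower bidiagonal with $(n,n)$-entry $\theta_n$ and all subdiagonal entries $1$, and $B$ is upper bidiagonal with $(n,n)$-entry $\theta^*_n$ and $(n-1,n)$-entry $\varphi_n$; in another basis $A$ is lower bidiagonal with $(n,n)$-entry $\theta_{d-n}$ and all subdiagonal entries $1$, and $B$ is upper bidiagonal with $(n,n)$-entry $\theta_n^*$ and $(n-1,n)$-entry $\phi_n$. This Leonard pair (and any isomorphic one) is said to correspond to $(a,b,c,d)$, and $(a,b,c,d)$ is called a feasible sequence for it. Leonard pairs arising in this way are said to have $q$-Racah type. For a Leonard pair $A,B$ on $V$ of $q$-Racah type with feasible sequence $(a,b,c,d)$, the $\mathbb Z_3$-symmetric completion is the (known to exist) unique $C\in{\rm End}(V)$ with $A+\frac{qBC-q^{-1}CB}{q^2-q^{-2}}=\frac{(a+a^{-1})(q^{d+1}+q^{-d-1})+(b+b^{-1})(c+c^{-1})}{q+q^{-1}}$,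 $B+\frac{qCA-q^{-1}AC}{q^2-q^{-2}}=\frac{(b+b^{-1})(q^{d+1}+q^{-d-1})+(c+c^{-1})(a+a^{-1})}{q+q^{-1}}$, $C+\frac{qAB-q^{-1}BA}{q^2-q^{-2}}=\frac{(c+c^{-1})(q^{d+1}+q^{-d-1})+(a+a^{-1})(b+b^{-1})}{q+q^{-1}}$ (scalars mean multiples of $I$). The dual $\mathbb Z_3$-symmetric completion of $A,B$ is the $\mathbb Z_3$-symmetric completion of the Leonard pair $B,A$ (which has $q$-Racah type with feasible sequence $(b,a,c,d)$). *)

theory Defs
  imports
    "HOL-Library.Numeral_Type"
    "HOL-Library.Poly_Mapping"
    "HOL-Algebra.QuotRing"
    "HOL-Algebra.Algebraic_Closure_Type"
    "Jordan_Normal_Form.Gauss_Jordan_Elimination"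
begin

section \<open>The \<open>q\<close>-tetrahedron algebra\<close>

text \<open>Here \<open>\<int>/4\<int>\<close> is the type \<^typ>\<open>4\<close>, whose arithmetic is modulo 4.\<close>

typedef tet_gen = "{(i :: 4, j :: 4). j - i = 1 \<or> j - i = 2}"
  by (intro exI[of _ "(0, 1)"]) simp

text \<open>
  Words over an alphabet form the free monoid, written additively because the product
  of \<^type>\<open>poly_mapping\<close> is the convolution along the addition of the keys.
  Accordingly \<open>'g word \<Rightarrow>\<^sub>0 'a\<close> is the free associative unital \<open>'a\<close>-algebra on \<open>'g\<close>.
\<close>

datatype 'g word = Word "'g list"

instantiation word :: (type) monoid_add
begin

definition zero_word :: "'a word" where "0 = Word []"

fun plus_word :: "'a word \<Rightarrow> 'a word \<Rightarrow> 'a word" where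
  "Word u + Word v = Word (u @ v)"

instance
proof
  fix u v w :: "'a word"
  show "u + v + w = u + (v + w)" by (cases u; cases v; cases w) simp
  show "0 + u = u" by (cases u) (simp add: zero_word_def)
  show "u + 0 = u" by (cases u) (simp add: zero_word_def)
qed

end

type_synonym 'a free_tet = "tet_gen word \<Rightarrow>\<^sub>0 'a"

definition gen_x :: "4 \<Rightarrow> 4 \<Rightarrow> 'a::ring_1 free_tet" where
  "gen_x i j = Poly_Mapping.single (Word [Abs_tet_gen (i, j)]) 1"

definition const :: "'a::ring_1 \<Rightarrow> 'a free_tet" where
  "const s = Poly_Mapping.single 0 s"

definition commutator :: "'r::ring \<Rightarrow> 'r \<Rightarrow> 'r" where
  "commutator u v = u * v - v * u"

definition q_int :: "'a::field \<Rightarrow> int \<Rightarrow> 'a" where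
  "q_int q n = (q powi n - q powi (- n)) / (q - inverse q)"

definition tet_relators :: "'a::field \<Rightarrow> 'a free_tet set" where
  "tet_relators q =
     {gen_x i j * gen_x j i - 1 | i j. j - i = 2}
   \<union> {const (1 / (q - inverse q))
          * (const q * gen_x i j * gen_x j k - const (inverse q) * gen_x j k * gen_x i j) - 1
        | i j k. (j - i, k - j) \<in> {(1, 1), (1, 2), (2, 1)}}
   \<union> {gen_x i j ^ 3 * gen_x k l
        - const (q_int q 3) * gen_x i j ^ 2 * gen_x k l * gen_x i j
        + const (q_int q 3) * gen_x i j * gen_x k l * gen_x i j ^ 2
        - gen_x k l * gen_x i j ^ 3
        | i j k l. j - i = 1 \<and> k - j = 1 \<and> l - k = 1}"

abbreviation free_tet_ring :: "'a::field free_tet ring" where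
  "free_tet_ring \<equiv> ring_of_type_algebra"

definition tet_ideal :: "'a::field \<Rightarrow> 'a free_tet set" where
  "tet_ideal q = Idl\<^bsub>free_tet_ring\<^esub> (tet_relators q)"

definition tet_algebra :: "'a::field \<Rightarrow> 'a free_tet set ring" where
  "tet_algebra q = free_tet_ring Quot tet_ideal q"

text \<open>The element of the \<open>q\<close>-tetrahedron algebra named by a noncommutative polynomial
  in the standard generators.\<close>

definition tet_elt :: "'a::field \<Rightarrow> 'a free_tet \<Rightarrow> 'a free_tet set" where
  "tet_elt q p = tet_ideal q +>\<^bsub>free_tet_ring\<^esub> p"

section \<open>Vector spaces, representing matrices, modules\<close>

text \<open>A vector space is the whole type \<open>'v\<close> with an explicit scalar multiplication.\<close>

definition End_ring :: "('a::field \<Rightarrow> 'v \<Rightarrow> 'v::ab_group_add) \<Rightarrow> ('v \<Rightarrow> 'v) ring" where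
  "End_ring scale =
     \<lparr>carrier = {f. Vector_Spaces.linear scale scale f}, monoid.mult = (\<circ>), one = id,
      zero = (\<lambda>v. 0), add = (\<lambda>f g v. f v + g v)\<rparr>"

text \<open>The last condition makes the ring homomorphism \<open>act\<close> a homomorphism of algebras.\<close>

definition tet_module ::
  "'a::field \<Rightarrow> ('a \<Rightarrow> 'v \<Rightarrow> 'v::ab_group_add) \<Rightarrow> ('a free_tet set \<Rightarrow> 'v \<Rightarrow> 'v) \<Rightarrow> bool" where
  "tet_module q scale act \<longleftrightarrow>
     vector_space scale \<and>
     act \<in> Ring.ring_hom (tet_algebra q) (End_ring scale) \<and>
     (\<forall>s. act (tet_elt q (const s)) = scale s)"

definition basis ::
  "('a::field \<Rightarrow> 'v \<Rightarrow> 'v::ab_group_add) \<Rightarrow> nat \<Rightarrow> (nat \<Rightarrow> 'v) \<Rightarrow> bool" where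
  "basis scale d v \<longleftrightarrow>
     vector_space scale \<and> inj_on v {..d} \<and>
     \<not> Modules.module.dependent scale (v ` {..d}) \<and>
     Modules.module.span scale (v ` {..d}) = UNIV"

definition represents ::
  "('a::field \<Rightarrow> 'v \<Rightarrow> 'v::ab_group_add) \<Rightarrow> nat \<Rightarrow> (nat \<Rightarrow> 'v) \<Rightarrow> 'a mat \<Rightarrow> ('v \<Rightarrow> 'v) \<Rightarrow> bool"
  where
  "represents scale d v M A \<longleftrightarrow>
     M \<in> carrier_mat (d + 1) (d + 1) \<and> Vector_Spaces.linear scale scale A \<and>
     (\<forall>n\<le>d. A (v n) = (\<Sum>i\<le>d. scale (M $$ (i, n)) (v i)))"

section \<open>The module \<open>V\<^sub>d(t)\<close>\<close>

definition Z_mat :: "nat \<Rightarrow> 'a::field mat" where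
  "Z_mat d = mat (d + 1) (d + 1) (\<lambda>(i, j). if i + j = d then 1 else 0)"

definition K_mat :: "nat \<Rightarrow> 'a::field \<Rightarrow> 'a mat" where
  "K_mat d q = mat (d + 1) (d + 1) (\<lambda>(i, j). if i = j then q powi (int d - 2 * int i) else 0)"

text \<open>The entries \<open>(i-1,i)\<close> appear below as the entries \<open>(i,j)\<close> with \<open>i + 1 = j\<close>,
  so that their formulas are in terms of the column index \<open>j\<close>.\<close>

definition E_mat :: "nat \<Rightarrow> 'a::field \<Rightarrow> 'a mat" where
  "E_mat d q = mat (d + 1) (d + 1) (\<lambda>(i, j).
     if i = j then q powi (2 * int i - int d)
     else if i + 1 = j then q powi int d - q powi (2 * int j - 2 - int d)
     else 0)"

definition G_mat :: "nat \<Rightarrow> 'a::field \<Rightarrow> 'a \<Rightarrow> 'a mat" where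
  "G_mat d q t = mat (d + 1) (d + 1) (\<lambda>(i, j).
     if i = j then q powi (2 * int i - int d)
     else if i + 1 = j then
       (q powi int d - q powi (2 * int j - 2 - int d)) * (1 - t * q powi (int d - 2 * int j + 1))
     else 0)"

definition L_mat :: "nat \<Rightarrow> 'a::field \<Rightarrow> 'a \<Rightarrow> 'a mat" where
  "L_mat d q t = mat (d + 1) (d + 1) (\<lambda>(i, j).
     if i = j then q powi (2 * int i - int d)
     else if i + 1 = j then
       (q powi int d - q powi (2 * int j - 2 - int d))
         * inverse (1 - t * q powi (int d - 2 * int j + 1))
     else 0)"

definition S_mat :: "nat \<Rightarrow> 'a::field \<Rightarrow> 'a \<Rightarrow> 'a mat" where
  "S_mat d q t = mat (d + 1) (d + 1) (\<lambda>(i, j).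
     if i + 1 = j then
       (q powi int d - q powi (2 * int j - int d - 2)) * (1 - t * q powi (2 * int j - int d - 1))
     else if i = j + 1 then
       (q powi (2 * int i - int d) - q powi (- int d)) * q powi (2 * int i - int d - 1) * t
     else if i = j then
       q powi int d
       - (q powi (2 * int i - int d) - q powi (- int d)) * q powi (2 * int i - int d - 1) * t
       - (q powi int d - q powi (2 * int i - int d)) * (1 - t * q powi (2 * int i - int d + 1))
     else 0)"

text \<open>
  \<open>act\<close> makes \<open>'v\<close> a module isomorphic to \<open>V\<^sub>d(t)\<close>, for \<open>d \<ge> 1\<close> and nonzero \<open>t\<close> not among
  the \<open>q\<^bsup>d-2n+1\<^esup>\<close> with \<open>1 \<le> n \<le> d\<close>. The two inverted matrices are triangular with
  nonzero diagonal entries, so \<^const>\<open>mat_inverse\<close> does return their inverse.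
\<close>

definition V_module ::
  "'a::field \<Rightarrow> nat \<Rightarrow> 'a \<Rightarrow> ('a \<Rightarrow> 'v \<Rightarrow> 'v::ab_group_add) \<Rightarrow> ('a free_tet set \<Rightarrow> 'v \<Rightarrow> 'v) \<Rightarrow> bool"
  where
  "V_module q d t scale act \<longleftrightarrow>
     tet_module q scale act \<and>
     (\<exists>v. basis scale d v \<and>
        (let rep = (\<lambda>i j M. represents scale d v M (act (tet_elt q (gen_x i j)))) in
          rep 0 1 (Z_mat d * S_mat d (inverse q) (inverse t) * Z_mat d) \<and>
          rep 1 2 (E_mat d q) \<and>
          rep 2 3 (K_mat d q) \<and>
          rep 3 0 (Z_mat d * G_mat d (inverse q) t * Z_mat d) \<and>
          rep 0 2 (L_mat d q t) \<and>
          rep 1 3 (the (mat_inverse (Z_mat d * E_mat d (inverse q) * Z_mat d))) \<and>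
          rep 2 0 (the (mat_inverse (L_mat d q t))) \<and>
          rep 3 1 (Z_mat d * E_mat d (inverse q) * Z_mat d)))"

section \<open>Leonard pairs of \<open>q\<close>-Racah type\<close>

definition irred_tridiagonal :: "'a::field mat \<Rightarrow> bool" where
  "irred_tridiagonal M \<longleftrightarrow>
     (\<forall>i<dim_row M. \<forall>j<dim_col M.
        (i + 1 < j \<or> j + 1 < i \<longrightarrow> M $$ (i, j) = 0) \<and>
        (i + 1 = j \<or> j + 1 = i \<longrightarrow> M $$ (i, j) \<noteq> 0))"

text \<open>A basis indexed by \<open>0, \<dots>, d\<close> makes the space nonzero and finite-dimensional.\<close>

definition leonard_pair ::
  "('a::field \<Rightarrow> 'v \<Rightarrow> 'v::ab_group_add) \<Rightarrow> ('v \<Rightarrow> 'v) \<Rightarrow> ('v \<Rightarrow> 'v) \<Rightarrow> bool" where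
  "leonard_pair scale A B \<longleftrightarrow>
     (\<exists>d.
       (\<exists>v M N. basis scale d v \<and> represents scale d v M A \<and> represents scale d v N B \<and>
          diagonal_mat M \<and> irred_tridiagonal N) \<and>
       (\<exists>v M N. basis scale d v \<and> represents scale d v M A \<and> represents scale d v N B \<and>
          irred_tridiagonal M \<and> diagonal_mat N))"

definition feasible :: "'a::field \<Rightarrow> 'a \<Rightarrow> 'a \<Rightarrow> 'a \<Rightarrow> nat \<Rightarrow> bool" where
  "feasible q a b c d \<longleftrightarrow>
     {a\<^sup>2, b\<^sup>2} \<inter> {q powi (2 * k) | k. 1 - int d \<le> k \<and> k \<le> int d - 1} = {} \<and>
     {a * b * c, inverse a * b * c, a * inverse b * c, a * b * inverse c}
       \<inter> {q powi (int d - 2 * int n + 1) | n. 1 \<le> n \<and> n \<le> d} = {}"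

text \<open>Both \<open>\<theta>\<^sub>n\<close> (with \<open>s = a\<close>) and \<open>\<theta>\<^sup>*\<^sub>n\<close> (with \<open>s = b\<close>).\<close>

definition theta :: "'a::field \<Rightarrow> nat \<Rightarrow> 'a \<Rightarrow> nat \<Rightarrow> 'a" where
  "theta q d s n = s * q powi (2 * int n - int d) + inverse s * q powi (int d - 2 * int n)"

definition varphi :: "'a::field \<Rightarrow> 'a \<Rightarrow> 'a \<Rightarrow> 'a \<Rightarrow> nat \<Rightarrow> nat \<Rightarrow> 'a" where
  "varphi q a b c d n =
     inverse a * inverse b * q powi (int d + 1)
     * (q powi int n - q powi (- int n))
     * (q powi (int n - int d - 1) - q powi (int d - int n + 1))
     * (q powi (- int n) - a * b * c * q powi (int n - int d - 1))
     * (q powi (- int n) - a * b * inverse c * q powi (int n - int d - 1))"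

definition phi :: "'a::field \<Rightarrow> 'a \<Rightarrow> 'a \<Rightarrow> 'a \<Rightarrow> nat \<Rightarrow> nat \<Rightarrow> 'a" where
  "phi q a b c d n =
     a * inverse b * q powi (int d + 1)
     * (q powi int n - q powi (- int n))
     * (q powi (int n - int d - 1) - q powi (int d - int n + 1))
     * (q powi (- int n) - inverse a * b * c * q powi (int n - int d - 1))
     * (q powi (- int n) - inverse a * b * inverse c * q powi (int n - int d - 1))"

definition lower_bidiag :: "nat \<Rightarrow> (nat \<Rightarrow> 'a::field) \<Rightarrow> 'a mat" where
  "lower_bidiag d th = mat (d + 1) (d + 1) (\<lambda>(i, j).
     if i = j then th i else if i = j + 1 then 1 else 0)"

definition upper_bidiag :: "nat \<Rightarrow> (nat \<Rightarrow> 'a::field) \<Rightarrow> (nat \<Rightarrow> 'a) \<Rightarrow> 'a mat" where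
  "upper_bidiag d th f = mat (d + 1) (d + 1) (\<lambda>(i, j).
     if i = j then th i else if i + 1 = j then f j else 0)"

text \<open>\<open>A, B\<close> is a Leonard pair that corresponds to \<open>(a, b, c, d)\<close>. The two split forms are
  invariant under simultaneous conjugation, so this covers all the pairs isomorphic to a
  given one.\<close>

definition corresponds ::
  "'a::field \<Rightarrow> ('a \<Rightarrow> 'v \<Rightarrow> 'v::ab_group_add) \<Rightarrow> ('v \<Rightarrow> 'v) \<Rightarrow> ('v \<Rightarrow> 'v) \<Rightarrow>
     'a \<Rightarrow> 'a \<Rightarrow> 'a \<Rightarrow> nat \<Rightarrow> bool" where
  "corresponds q scale A B a b c d \<longleftrightarrow>
     a \<noteq> 0 \<and> b \<noteq> 0 \<and> c \<noteq> 0 \<and> d \<ge> 1 \<and> feasible q a b c d \<and>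
     leonard_pair scale A B \<and>
     (\<exists>v. basis scale d v \<and>
        represents scale d v (lower_bidiag d (theta q d a)) A \<and>
        represents scale d v (upper_bidiag d (theta q d b) (varphi q a b c d)) B) \<and>
     (\<exists>v. basis scale d v \<and>
        represents scale d v (lower_bidiag d (\<lambda>n. theta q d a (d - n))) A \<and>
        represents scale d v (upper_bidiag d (theta q d b) (phi q a b c d)) B)"

definition q_Racah_type ::
  "'a::field \<Rightarrow> ('a \<Rightarrow> 'v \<Rightarrow> 'v::ab_group_add) \<Rightarrow> ('v \<Rightarrow> 'v) \<Rightarrow> ('v \<Rightarrow> 'v) \<Rightarrow> bool" where
  "q_Racah_type q scale A B \<longleftrightarrow> (\<exists>a b c d. corresponds q scale A B a b c d)"

definition Z3_equation ::
  "'a::field \<Rightarrow> ('a \<Rightarrow> 'v \<Rightarrow> 'v::ab_group_add) \<Rightarrow> nat \<Rightarrow> 'a \<Rightarrow> 'a \<Rightarrow> 'a \<Rightarrow>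
     ('v \<Rightarrow> 'v) \<Rightarrow> ('v \<Rightarrow> 'v) \<Rightarrow> ('v \<Rightarrow> 'v) \<Rightarrow> bool" where
  "Z3_equation q scale d a b c A B C \<longleftrightarrow>
     (\<forall>v. A v + scale (1 / (q\<^sup>2 - inverse (q\<^sup>2)))
                  (scale q (B (C v)) - scale (inverse q) (C (B v)))
        = scale (((a + inverse a) * (q ^ (d + 1) + inverse (q ^ (d + 1)))
                    + (b + inverse b) * (c + inverse c)) / (q + inverse q)) v)"

text \<open>\<open>C\<close> is the \<open>\<int>\<^sub>3\<close>-symmetric completion of \<open>A, B\<close>, computed with the feasible sequence
  \<open>(a, b, c, d)\<close>; the third equation makes it unique.\<close>

definition Z3_completion ::
  "'a::field \<Rightarrow> ('a \<Rightarrow> 'v \<Rightarrow> 'v::ab_group_add) \<Rightarrow> 'a \<Rightarrow> 'a \<Rightarrow> 'a \<Rightarrow> nat \<Rightarrow>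
     ('v \<Rightarrow> 'v) \<Rightarrow> ('v \<Rightarrow> 'v) \<Rightarrow> ('v \<Rightarrow> 'v) \<Rightarrow> bool" where
  "Z3_completion q scale a b c d A B C \<longleftrightarrow>
     corresponds q scale A B a b c d \<and>
     Vector_Spaces.linear scale scale C \<and>
     Z3_equation q scale d a b c A B C \<and>
     Z3_equation q scale d b c a B C A \<and>
     Z3_equation q scale d c a b C A B"

lemma Z3_completion_unique:
  assumes "Z3_completion q scale a b c d A B C" and "Z3_completion q scale a b c d A B C'"
  shows "C = C'"
proof
  fix v
  show "C v = C' v"
    using assms unfolding Z3_completion_def Z3_equation_def by (metis add_right_cancel)
qed

text \<open>The pair \<open>B, A\<close> has feasible sequence \<open>(b, a, c, d)\<close>.\<close>

definition dual_Z3_completion ::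
  "'a::field \<Rightarrow> ('a \<Rightarrow> 'v \<Rightarrow> 'v::ab_group_add) \<Rightarrow> 'a \<Rightarrow> 'a \<Rightarrow> 'a \<Rightarrow> nat \<Rightarrow>
     ('v \<Rightarrow> 'v) \<Rightarrow> ('v \<Rightarrow> 'v) \<Rightarrow> ('v \<Rightarrow> 'v) \<Rightarrow> bool" where
  "dual_Z3_completion q scale a b c d A B C \<longleftrightarrow> Z3_completion q scale b a c d B A C"

end

theory Submission
  imports Defs
begin

text \<open>
  Write \<open>x\<^sub>0, x\<^sub>1, x\<^sub>2, x\<^sub>3\<close> for the actions of \<open>x\<^bsub>01\<^esub>, x\<^bsub>12\<^esub>, x\<^bsub>23\<^esub>, x\<^bsub>30\<^esub>\<close> on \<open>V\<^sub>d(t)\<close>. Cyclically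
  adjacent ones satisfy a \<open>q\<close>-Weyl relation in the \<open>q\<close>-tetrahedron algebra. On \<open>V\<^sub>d(t)\<close> the products
  of opposite ones are moreover linear: with \<open>\<Lambda> = q\<^bsup>d+1\<^esup> + q\<^bsup>-d-1\<^esup>\<close>,
  \<open>t (x\<^sub>0 x\<^sub>2 - 1) + q x\<^sub>3 + q\<^sup>-\<^sup>1 x\<^sub>1 = \<Lambda>\<close> and \<open>t\<^sup>-\<^sup>1 (x\<^sub>1 x\<^sub>3 - 1) + q x\<^sub>0 + q\<^sup>-\<^sup>1 x\<^sub>2 = \<Lambda>\<close>, and the same after
  shifting the indices by 2; these say that the Casimir element of the quantum group of \<open>sl\<^sub>2\<close> acts as
  a scalar. These eight relations and an eigenbasis of \<open>x\<^sub>2\<close> with eigenvalues \<open>q\<^bsup>d-2n\<^esup>\<close> form the locale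
  \<open>evaluation_module\<close>, and everything else is derived from it.
  
  The locale is invariant under shifting the indices by 2 (\<open>rotated_module\<close>). This shift exchanges
  \<open>A\<close> with \<open>B\<close>, \<open>a\<close> with \<open>b\<close>, and the two candidates for the completions, so whatever is proved about
  \<open>A, B\<close> and its \<open>\<int>\<^sub>3\<close>-symmetric completion holds for \<open>B, A\<close> and the dual completion.
  
  The \<open>\<int>\<^sub>3\<close>-symmetric equations (\<open>Z3_equations\<close>) come out by normalizing words of length three; the
  value \<open>t = a b c\<^sup>-\<^sup>1\<close> is what makes the quadratic terms cancel.
  
  The split forms use the equations (\<open>split_recursion\<close>). Start at the eigenvector \<open>u\<^sub>0\<close> of \<open>B\<close> for \<open>\<theta>\<^sup>*\<^sub>0\<close>
  and let \<open>u\<^bsub>n+1\<^esub> = (A - \<theta>\<^sub>n) u\<^sub>n\<close>. The equations rewrite \<open>B A\<close> and \<open>C A\<close> through \<open>A B\<close>, \<open>A C\<close> and linear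
  terms, so the action of \<open>B\<close> and \<open>C\<close> on \<open>u\<^bsub>n+1\<^esub>\<close> follows from the one on \<open>u\<^sub>n\<close>, and \<open>\<phi>\<^sub>n\<close> appears. The
  equations do not distinguish \<open>a\<close> from \<open>a\<^sup>-\<^sup>1\<close>; exchanging these two reverses the order of the \<open>\<theta>\<^sub>n\<close> and
  yields the second split form. That \<open>u\<^sub>0, \<dots>, u\<^sub>d\<close> is a basis is seen in the eigenbasis of \<open>x\<^sub>2\<close>, where
  \<open>A\<close> lowers the index with nonzero coefficients because \<open>a b\<^sup>-\<^sup>1 c\<close> avoids the forbidden powers of \<open>q\<close>;
  and \<open>u\<^bsub>d+1\<^esub> = 0\<close> because \<open>A\<close> is triangular in an eigenbasis of \<open>x\<^sub>1\<close>, with eigenvalues \<open>\<theta>\<^sub>0, \<dots>, \<theta>\<^sub>d\<close>.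
  
  The two split forms list the eigenvalues of \<open>A\<close> in opposite orders. In an eigenbasis of \<open>A\<close> one of them
  bounds \<open>B\<close> to at most one step down and the other to at most one step up, with nonzero steps as no
  \<open>\<phi>\<^sub>n\<close> vanishes (\<open>half_leonard_pair\<close>). Together with the rotated module this is the Leonard property.
\<close>

section \<open>Coordinates and triangular changes of basis\<close>

text \<open>
  A separate copy of \<open>vector_space\<close>, so that the constants declared in it stay independent of the
  interpretations of that locale for real vector spaces.
\<close>

locale coord_space = vector_space scale
  for scale :: "'a::field \<Rightarrow> 'v::ab_group_add \<Rightarrow> 'v"
begin

definition coord :: "nat \<Rightarrow> (nat \<Rightarrow> 'v) \<Rightarrow> nat \<Rightarrow> 'v \<Rightarrow> 'a" where
  "coord d v i x = representation (v ` {..d}) x (v i)"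

lemma linear_coord:
  assumes "basis scale d v"
  shows "Vector_Spaces.linear scale (*) (coord d v i)"
  unfolding coord_def by (rule linear_representation) (use assms in \<open>auto simp: basis_def\<close>)

lemma coord_add: "basis scale d v \<Longrightarrow> coord d v i (x + y) = coord d v i x + coord d v i y"
  and coord_diff: "basis scale d v \<Longrightarrow> coord d v i (x - y) = coord d v i x - coord d v i y"
  and coord_scale: "basis scale d v \<Longrightarrow> coord d v i (scale s x) = s * coord d v i x"
  and coord_zero: "basis scale d v \<Longrightarrow> coord d v i 0 = 0"
  and coord_sum: "basis scale d v \<Longrightarrow> coord d v i (sum g S) = (\<Sum>j\<in>S. coord d v i (g j))"
  using linear_coord[of d v i]
  by (auto simp: Vector_Spaces.linear_def module_hom.add module_hom.scale module_hom.diff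
      module_hom.zero module_hom.sum)

lemma coord_basis:
  assumes "basis scale d v" "j \<le> d" "i \<le> d"
  shows "coord d v i (v j) = (if i = j then 1 else 0)"
proof -
  have "representation (v ` {..d}) (v j) = (\<lambda>x. if x = v j then 1 else 0)"
    by (rule representation_basis) (use assms in \<open>auto simp: basis_def\<close>)
  then show ?thesis
    using assms unfolding coord_def basis_def by (auto dest: inj_onD)
qed

lemma basis_expansion:
  assumes "basis scale d v"
  shows "x = (\<Sum>i\<le>d. scale (coord d v i x) (v i))"
proof -
  have "(\<Sum>b\<in>v ` {..d}. scale (representation (v ` {..d}) x b) b) = x"
    by (rule sum_representation_eq) (use assms in \<open>auto simp: basis_def\<close>)
  then show ?thesis
    using assms by (simp add: sum.reindex basis_def coord_def)
qed

lemma eq_if_coord_eq: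
  assumes "basis scale d v" "\<And>i. i \<le> d \<Longrightarrow> coord d v i x = coord d v i y"
  shows "x = y"
  using basis_expansion[OF assms(1), of x] basis_expansion[OF assms(1), of y] assms(2)
  by (metis (no_types, lifting) atMost_iff sum.cong)

lemma linear_expansion:
  assumes "basis scale d v" "Vector_Spaces.linear scale scale f"
  shows "f x = (\<Sum>i\<le>d. scale (coord d v i x) (f (v i)))"
proof -
  interpret f: Vector_Spaces.linear scale scale f by fact
  show ?thesis
    by (subst basis_expansion[OF assms(1), of x]) (simp add: f.sum f.scale)
qed

lemma linear_eq_on_basis:
  assumes "basis scale d v" "Vector_Spaces.linear scale scale f" "Vector_Spaces.linear scale scale g"
    and "\<And>i. i \<le> d \<Longrightarrow> f (v i) = g (v i)"
  shows "f x = g x"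
  by (subst (1 2) linear_expansion[OF assms(1)]) (use assms in \<open>auto intro!: sum.cong\<close>)

lemma coord_eq_0_if_in_span:
  assumes "basis scale d v" "x \<in> span (v ` I)" "i \<notin> I" "I \<subseteq> {..d}" "i \<le> d"
  shows "coord d v i x = 0"
  using assms(2)
proof (induction rule: span_induct_alt)
  case base
  then show ?case by (simp add: coord_zero assms)
next
  case (step c x y)
  then obtain m where "m \<in> I" "x = v m" by auto
  moreover have "m \<le> d" "m \<noteq> i" using \<open>m \<in> I\<close> assms by auto
  ultimately show ?case using step.IH assms
    by (simp add: coord_add coord_scale coord_basis)
qed

lemma represents_coord:
  assumes "basis scale d v" "Vector_Spaces.linear scale scale T"
  shows "represents scale d v (mat (d + 1) (d + 1) (\<lambda>(i, n). coord d v i (T (v n)))) T"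
proof -
  have "T (v n) = (\<Sum>i\<le>d. scale (coord d v i (T (v n))) (v i))" for n
    by (rule basis_expansion) fact
  then show ?thesis
    using assms unfolding represents_def by (auto intro!: sum.cong)
qed

text \<open>
  The \<open>d + 1\<close> vectors cannot repeat or be dependent, since they span a space of dimension \<open>d + 1\<close>.
\<close>

lemma basis_if_spanning:
  assumes v: "basis scale d v" and w: "v ` {..d} \<subseteq> span (w ` {..d})"
  shows "basis scale d w"
proof -
  interpret f: finite_dimensional_vector_space scale "v ` {..d}"
    by unfold_locales (use v in \<open>auto simp: basis_def\<close>)
  have dim: "dim UNIV = d + 1"
    using v dim_eq_card_independent[of "v ` {..d}"] dim_span[of "v ` {..d}"]
    by (simp add: basis_def card_image)
  have span: "span (w ` {..d}) = UNIV"
    using span_mono[OF w] v by (auto simp: basis_def span_span)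
  have "dim UNIV \<le> card (w ` {..d})"
    using dim_le_card[of UNIV "w ` {..d}"] span by auto
  moreover have "card (w ` {..d}) \<le> d + 1"
    using card_image_le[of "{..d}" w] by simp
  ultimately have card: "card (w ` {..d}) = d + 1" using dim by simp
  then have "inj_on w {..d}" by (intro eq_card_imp_inj_on) auto
  moreover have "\<not> dependent (w ` {..d})"
    using f.card_le_dim_spanning[of "w ` {..d}" UNIV] span card dim by auto
  ultimately show ?thesis using span vector_space_axioms by (simp add: basis_def)
qed

lemma basis_reverse:
  assumes "basis scale d v"
  shows "basis scale d (\<lambda>n. v (d - n))"
proof (rule basis_if_spanning[OF assms])
  have "v n \<in> span ((\<lambda>n. v (d - n)) ` {..d})" if "n \<le> d" for n
    by (rule span_base) (rule image_eqI[of _ _ "d - n"], use that in auto)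
  then show "v ` {..d} \<subseteq> span ((\<lambda>n. v (d - n)) ` {..d})" by auto
qed

lemma triangular_span:
  fixes n :: nat
  assumes "\<forall>m<n. w m - scale (k m) (u m) \<in> span (u ` {..<m})"
    and "\<forall>m<n. k m \<noteq> 0"
  shows "span (u ` {..<n}) = span (w ` {..<n})"
  using assms
proof (induction n)
  case (Suc n)
  have IH: "span (u ` {..<n}) = span (w ` {..<n})"
    by (rule Suc.IH) (use Suc.prems in auto)
  have k: "k n \<noteq> 0" and w: "w n - scale (k n) (u n) \<in> span (u ` {..<n})"
    using Suc.prems by auto
  have mono: "span (u ` {..<n}) \<subseteq> span (u ` {..<Suc n})"
    "span (w ` {..<n}) \<subseteq> span (w ` {..<Suc n})"
    by (intro span_mono; auto)+
  have "scale (k n) (u n) \<in> span (u ` {..<Suc n})"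
    by (intro span_scale span_base) auto
  then have "(w n - scale (k n) (u n)) + scale (k n) (u n) \<in> span (u ` {..<Suc n})"
    using w mono by (intro span_add) auto
  then have 1: "w n \<in> span (u ` {..<Suc n})" by simp
  have "w n \<in> span (w ` {..<Suc n})" by (intro span_base) auto
  then have "scale (inverse (k n)) (w n - (w n - scale (k n) (u n))) \<in> span (w ` {..<Suc n})"
    by (intro span_scale, rule span_diff) (use w mono(2) in \<open>auto simp only: IH\<close>)
  moreover have "scale (inverse (k n)) (w n - (w n - scale (k n) (u n))) = u n"
    using k by simp
  ultimately have 2: "u n \<in> span (w ` {..<Suc n})" by (simp only:)
  have "u ` {..<n} \<subseteq> span (w ` {..<Suc n})" "w ` {..<n} \<subseteq> span (u ` {..<Suc n})"
    using mono span_superset[of "u ` {..<n}"] span_superset[of "w ` {..<n}"]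
    unfolding IH by (meson subset_trans)+
  then show ?case
    using 1 2 unfolding span_eq by (auto simp: lessThan_Suc)
qed simp

lemma triangular_basis:
  assumes u: "basis scale d u"
    and tri: "\<And>n. n \<le> d \<Longrightarrow> w n - scale (k n) (u n) \<in> span (u ` {..<n})"
    and k: "\<And>n. n \<le> d \<Longrightarrow> k n \<noteq> 0"
  shows "basis scale d w"
proof (rule basis_if_spanning[OF u])
  have "span (u ` {..<Suc d}) = span (w ` {..<Suc d})"
    by (rule triangular_span[where k = k]) (use tri k in auto)
  then show "u ` {..d} \<subseteq> span (w ` {..d})"
    by (simp add: lessThan_Suc_atMost) (metis span_superset)
qed

text \<open>
  By induction on \<open>n\<close>: the span of the earlier \<open>u m\<close> is also spanned by the eigenvectors \<open>w m\<close> already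
  found, so \<open>T - th n\<close> is invertible there because \<open>th n\<close> differs from their eigenvalues; its inverse
  yields the correction that turns \<open>u n\<close> into an eigenvector.
\<close>

lemma triangular_eigenbasis:
  assumes u: "basis scale d u" and T: "Vector_Spaces.linear scale scale T"
    and tri: "\<And>n. n \<le> d \<Longrightarrow> T (u n) - scale (th n) (u n) \<in> span (u ` {..<n})"
    and th: "inj_on th {..d}"
  obtains w where "basis scale d w" "\<And>n. n \<le> d \<Longrightarrow> T (w n) = scale (th n) (w n)"
    "\<And>n. n \<le> d \<Longrightarrow> w n - u n \<in> span (u ` {..<n})"
proof -
  interpret T: Vector_Spaces.linear scale scale T by fact
  have ex: "\<exists>y. T y = scale (th n) y \<and> y - u n \<in> span (u ` {..<n})" if "n \<le> d" for n
    using that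
  proof (induction n rule: less_induct)
    case (less n)
    then have "\<forall>m. \<exists>y. m < n \<longrightarrow> T y = scale (th m) y \<and> y - u m \<in> span (u ` {..<m})"
      by (metis less_imp_le order_trans)
    then obtain w where w: "\<And>m. m < n \<Longrightarrow> T (w m) = scale (th m) (w m)"
      "\<And>m. m < n \<Longrightarrow> w m - u m \<in> span (u ` {..<m})" by metis
    have sp: "span (u ` {..<n}) = span (w ` {..<n})"
      by (rule triangular_span[where k = "\<lambda>_. 1"]) (use w in auto)
    have "\<exists>x \<in> span (w ` {..<n}). T x - scale (th n) x = z" if "z \<in> span (w ` {..<n})" for z
      using that
    proof (induction rule: span_induct_alt)
      case base
      then show ?case by (intro bexI[of _ 0]) (auto simp: T.zero span_zero)
    next
      case (step c y z)
      then obtain m x where m: "m < n" "y = w m" and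
        x: "x \<in> span (w ` {..<n})" "T x - scale (th n) x = z" by auto
      define e where "e = c / (th m - th n)"
      have ne: "th m - th n \<noteq> 0" using th m less.prems by (auto dest: inj_onD)
      have "T (scale e (w m) + x) - scale (th n) (scale e (w m) + x)
        = scale (e * (th m - th n)) (w m) + (T x - scale (th n) x)"
        by (simp add: T.add T.scale w m scale_right_distrib scale_left_diff_distrib
            right_diff_distrib mult.commute)
      also have "\<dots> = scale c y + z" using x ne m by (simp add: e_def)
      finally show ?case
        using m x by (intro bexI[of _ "scale e (w m) + x"]) (auto intro!: span_add span_scale intro: span_base)
    qed
    then obtain x where x: "x \<in> span (u ` {..<n})"
      "T x - scale (th n) x = - (T (u n) - scale (th n) (u n))"
      using tri[OF less.prems] span_neg sp by metis
    have "T (u n + x) = scale (th n) (u n + x)"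
      using x(2) by (simp add: T.add scale_right_distrib algebra_simps)
    then show ?case using x(1) by (intro exI[of _ "u n + x"]) auto
  qed
  then obtain w where w: "\<And>n. n \<le> d \<Longrightarrow> T (w n) = scale (th n) (w n)"
    "\<And>n. n \<le> d \<Longrightarrow> w n - u n \<in> span (u ` {..<n})" by metis
  moreover have "basis scale d w"
    by (rule triangular_basis[OF u, where k = "\<lambda>_. 1"]) (use w in auto)
  ultimately show thesis by (rule that[rotated])
qed

lemma coord_eigenbasis:
  assumes w: "basis scale d w" and T: "Vector_Spaces.linear scale scale T"
    and eig: "\<And>n. n \<le> d \<Longrightarrow> T (w n) = scale (th n) (w n)" and i: "i \<le> d"
  shows "coord d w i (T x) = th i * coord d w i x"
proof -
  have "coord d w i (T x) = (\<Sum>j\<le>d. coord d w j x * coord d w i (T (w j)))"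
    by (subst linear_expansion[OF w T, of x]) (simp add: coord_sum[OF w] coord_scale[OF w])
  also have "\<dots> = (\<Sum>j\<le>d. if j = i then th i * coord d w i x else 0)"
    using i by (intro sum.cong) (auto simp: eig coord_scale[OF w] coord_basis[OF w])
  finally show ?thesis using i by simp
qed

lemma eigenvector_coord:
  assumes w: "basis scale d w" and T: "Vector_Spaces.linear scale scale T"
    and eig: "\<And>n. n \<le> d \<Longrightarrow> T (w n) = scale (th n) (w n)"
    and x: "T x = scale l x" and i: "i \<le> d" "th i \<noteq> l"
  shows "coord d w i x = 0"
  using coord_eigenbasis[OF w T eig i(1), of x] i(2) by (simp add: x coord_scale[OF w])

lemma eigenvector_multiple:
  assumes w: "basis scale d w" and T: "Vector_Spaces.linear scale scale T"
    and eig: "\<And>n. n \<le> d \<Longrightarrow> T (w n) = scale (th n) (w n)"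
    and x: "T x = scale l x" and ne: "\<And>n. n \<le> d \<Longrightarrow> n \<noteq> m \<Longrightarrow> th n \<noteq> l" and m: "m \<le> d"
  shows "x = scale (coord d w m x) (w m)"
proof (rule eq_if_coord_eq[OF w])
  fix i assume "i \<le> d"
  then show "coord d w i x = coord d w i (scale (coord d w m x) (w m))"
    using eigenvector_coord[OF w T eig x, of i] ne m
    by (auto simp: coord_scale[OF w] coord_basis[OF w])
qed

end

section \<open>Leonard pairs from two split forms\<close>
context coord_space
begin

text \<open>
  Half of tridiagonality. The eigenvectors of \<open>T\<close> span the same increasing flag as the basis \<open>u\<close>, and \<open>S\<close>
  moves each step of this flag exactly one step up. So \<open>S\<close> sends an eigenvector at most one step up,
  and the step is nonzero. The eigenbasis \<open>w\<close> is arbitrary, which permits applying the lemma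
  twice to one and the same basis.
\<close>

lemma split_basis_raises_eigenvector:
  assumes u: "basis scale d u" and T: "Vector_Spaces.linear scale scale T"
    and S: "Vector_Spaces.linear scale scale S"
    and Tu: "\<And>n. n \<le> d \<Longrightarrow> T (u n) - scale (th n) (u n) \<in> span (u ` {..<n})"
    and th: "inj_on th {..d}"
    and Su: "\<And>n. n \<le> d \<Longrightarrow> S (u n) = scale (s n) (u n) + (if n < d then scale (f n) (u (Suc n)) else 0)"
    and f: "\<And>n. n < d \<Longrightarrow> f n \<noteq> 0"
    and w: "basis scale d w" and Tw: "\<And>n. n \<le> d \<Longrightarrow> T (w n) = scale (th n) (w n)"
  shows "\<And>i n. n \<le> d \<Longrightarrow> i \<le> d \<Longrightarrow> Suc n < i \<Longrightarrow> coord d w i (S (w n)) = 0"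
    and "\<And>n. n < d \<Longrightarrow> coord d w (Suc n) (S (w n)) \<noteq> 0"
proof -
  interpret S: Vector_Spaces.linear scale scale S by fact
  obtain y where y: "basis scale d y" and Ty: "\<And>n. n \<le> d \<Longrightarrow> T (y n) = scale (th n) (y n)"
    and yu: "\<And>n. n \<le> d \<Longrightarrow> y n - u n \<in> span (u ` {..<n})"
    using triangular_eigenbasis[OF u T Tu th] by blast
  have sp: "span (u ` {..<n}) = span (y ` {..<n})" if "n \<le> Suc d" for n
    by (rule triangular_span[where k = "\<lambda>_. 1"]) (use yu that in auto)
  define k where "k n = coord d w n (y n)" for n
  have yw: "y n = scale (k n) (w n)" if "n \<le> d" for n
    unfolding k_def
    by (rule eigenvector_multiple[OF w T Tw Ty[OF that]]) (use th that in \<open>auto dest: inj_onD\<close>)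
  have k: "k n \<noteq> 0" if "n \<le> d" for n
  proof
    assume "k n = 0"
    then have "y n = 0" using yw[OF that] by simp
    then show False using coord_basis[OF y that that] coord_zero[OF y] by simp
  qed
  have spw: "span (u ` {..<n}) = span (w ` {..<n})" if "n \<le> Suc d" for n
    unfolding sp[OF that]
    by (rule sym, rule triangular_span[where k = k]) (use yw k that in \<open>auto simp: span_zero\<close>)
  have Sspan: "S x \<in> span (u ` {..<Suc n})" if "x \<in> span (u ` {..<n})" "n \<le> d" for x n
    using that(1)
  proof (induction rule: span_induct_alt)
    case (step c x z)
    then obtain m where m: "m < n" "x = u m" by auto
    then have "S x \<in> span (u ` {..<Suc n})"
      using Su[of m] that(2) by (auto intro!: span_add span_scale intro: span_base)
    with step show ?case by (simp add: S.add S.scale span_add span_scale)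
  qed (simp add: S.zero span_zero)
  have main: "S (w n) - scale (k (Suc n) * f n / k n) (w (Suc n)) \<in> span (w ` {..<Suc n})"
    if n: "n < d" for n
  proof -
    have 1: "S (y n) - S (u n) \<in> span (u ` {..<Suc n})"
      using Sspan[OF yu[of n]] n by (simp add: S.diff)
    have 2: "S (u n) - scale (f n) (u (Suc n)) \<in> span (u ` {..<Suc n})"
      using Su[of n] n by (auto intro!: span_scale intro: span_base)
    have 3: "scale (f n) (y (Suc n) - u (Suc n)) \<in> span (u ` {..<Suc n})"
      using yu[of "Suc n"] n by (intro span_scale) auto
    have "S (y n) - scale (f n) (y (Suc n)) \<in> span (u ` {..<Suc n})"
      using span_diff[OF span_add[OF 1 2] 3] by (simp add: scale_right_diff_distrib)
    then have "scale (inverse (k n)) (S (y n) - scale (f n) (y (Suc n))) \<in> span (w ` {..<Suc n})"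
      using spw[of "Suc n"] n by (intro span_scale) simp
    moreover have "scale (inverse (k n)) (S (y n) - scale (f n) (y (Suc n)))
        = S (w n) - scale (k (Suc n) * f n / k n) (w (Suc n))"
      using n k[of n] unfolding yw[OF less_imp_le[OF n]] yw[OF Suc_leI[OF n]]
      by (simp add: S.scale scale_right_diff_distrib divide_inverse mult.commute mult.left_commute)
    ultimately show ?thesis by (simp only:)
  qed
  show "coord d w i (S (w n)) = 0" if "n \<le> d" "i \<le> d" "Suc n < i" for i n
  proof -
    have "n < d" "{..<Suc n} \<subseteq> {..d}" using that by auto
    from coord_eq_0_if_in_span[OF w main[OF this(1)], of i] this that show ?thesis
      by (auto simp: coord_diff[OF w] coord_scale[OF w] coord_basis[OF w])
  qed
  show "coord d w (Suc n) (S (w n)) \<noteq> 0" if "n < d" for n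
  proof -
    have "{..<Suc n} \<subseteq> {..d}" using that by auto
    then show ?thesis
    using coord_eq_0_if_in_span[OF w main[OF that], of "Suc n"] that f[OF that] k[of n] k[of "Suc n"]
    by (auto simp: coord_diff[OF w] coord_scale[OF w] coord_basis[OF w])
  qed
qed

definition split_form :: "nat \<Rightarrow> ('v \<Rightarrow> 'v) \<Rightarrow> ('v \<Rightarrow> 'v) \<Rightarrow>
    (nat \<Rightarrow> 'a) \<Rightarrow> (nat \<Rightarrow> 'a) \<Rightarrow> (nat \<Rightarrow> 'a) \<Rightarrow> bool" where
  "split_form d A B th ths f \<longleftrightarrow>
    (\<exists>u. basis scale d u \<and> represents scale d u (lower_bidiag d th) A \<and>
         represents scale d u (upper_bidiag d ths f) B)"

lemma represents_lower_bidiag_iff: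
  "represents scale d u (lower_bidiag d th) A \<longleftrightarrow> Vector_Spaces.linear scale scale A \<and>
    (\<forall>n\<le>d. A (u n) = scale (th n) (u n) + (if n < d then u (Suc n) else 0))"
proof -
  have "(\<Sum>i\<le>d. scale (lower_bidiag d th $$ (i, n)) (u i))
     = scale (th n) (u n) + (if n < d then u (Suc n) else 0)" if "n \<le> d" for n
  proof -
    have "(\<Sum>i\<le>d. scale (lower_bidiag d th $$ (i, n)) (u i))
      = (\<Sum>i\<le>d. (if i = n then scale (th n) (u n) else 0) + (if i = Suc n then u (Suc n) else 0))"
      by (intro sum.cong) (use that in \<open>auto simp: lower_bidiag_def\<close>)
    then show ?thesis using that by (auto simp: sum.distrib)
  qed
  then show ?thesis unfolding represents_def by (auto simp: lower_bidiag_def)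
qed

lemma represents_upper_bidiag_iff:
  "represents scale d u (upper_bidiag d th f) A \<longleftrightarrow> Vector_Spaces.linear scale scale A \<and>
    (\<forall>n\<le>d. A (u n) = scale (th n) (u n) + (if 0 < n then scale (f n) (u (n - 1)) else 0))"
proof -
  have "(\<Sum>i\<le>d. scale (upper_bidiag d th f $$ (i, n)) (u i))
     = scale (th n) (u n) + (if 0 < n then scale (f n) (u (n - 1)) else 0)" if "n \<le> d" for n
  proof -
    have "(\<Sum>i\<le>d. scale (upper_bidiag d th f $$ (i, n)) (u i))
      = (\<Sum>i\<le>d. (if i = n then scale (th n) (u n) else 0)
          + (if i = n - 1 then (if 0 < n then scale (f n) (u (n - 1)) else 0) else 0))"
      by (intro sum.cong) (use that in \<open>auto simp: upper_bidiag_def\<close>)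
    then show ?thesis using that by (auto simp: sum.distrib)
  qed
  then show ?thesis unfolding represents_def by (auto simp: upper_bidiag_def)
qed

text \<open>
  Read backwards, each split basis shows that \<open>B\<close> moves an eigenvector of \<open>A\<close> exactly one step in
  one direction. The two bases list the eigenvalues in opposite orders, hence control opposite directions.
\<close>

lemma half_leonard_pair:
  assumes 1: "split_form d A B th ths f" and 2: "split_form d A B (\<lambda>n. th (d - n)) ths g"
    and th: "inj_on th {..d}"
    and f: "\<And>n. 1 \<le> n \<Longrightarrow> n \<le> d \<Longrightarrow> f n \<noteq> 0" and g: "\<And>n. 1 \<le> n \<Longrightarrow> n \<le> d \<Longrightarrow> g n \<noteq> 0"
  shows "\<exists>w M N. basis scale d w \<and> represents scale d w M A \<and> represents scale d w N B \<and>
          diagonal_mat M \<and> irred_tridiagonal N"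
proof -
  have flip: "\<exists>u. basis scale d u \<and> Vector_Spaces.linear scale scale A \<and> Vector_Spaces.linear scale scale B \<and>
      (\<forall>n\<le>d. A (u n) - scale (th (d - n)) (u n) \<in> span (u ` {..<n})) \<and>
      (\<forall>n\<le>d. B (u n) = scale (ths (d - n)) (u n)
          + (if n < d then scale (f (d - n)) (u (Suc n)) else 0))"
    if sf: "split_form d A B th ths f" for th f
  proof -
    obtain u where u: "basis scale d u" and lin: "Vector_Spaces.linear scale scale A" "Vector_Spaces.linear scale scale B"
      and Au: "\<And>n. n \<le> d \<Longrightarrow> A (u n) = scale (th n) (u n) + (if n < d then u (Suc n) else 0)"
      and Bu: "\<And>n. n \<le> d \<Longrightarrow> B (u n) = scale (ths n) (u n)
          + (if 0 < n then scale (f n) (u (n - 1)) else 0)"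
      using sf unfolding split_form_def represents_lower_bidiag_iff represents_upper_bidiag_iff by blast
    let ?u = "\<lambda>n. u (d - n)"
    have "A (?u n) - scale (th (d - n)) (?u n) \<in> span (?u ` {..<n})" if "n \<le> d" for n
    proof (cases n)
      case (Suc m)
      then have "A (?u n) - scale (th (d - n)) (?u n) = ?u m" 
        using Au[of "d - n"] that by (simp add: Suc_diff_Suc)
      then show ?thesis using Suc by (auto intro: span_base)
    qed (simp add: Au span_zero)
    moreover have "B (?u n) = scale (ths (d - n)) (?u n)
        + (if n < d then scale (f (d - n)) (?u (Suc n)) else 0)" if "n \<le> d" for n
      using Bu[of "d - n"] that by (auto simp: )
    ultimately show ?thesis using basis_reverse[OF u] lin by (intro exI[of _ ?u]) auto
  qed
  obtain u where u: "basis scale d u" and lin: "Vector_Spaces.linear scale scale A" "Vector_Spaces.linear scale scale B"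
    and Au: "\<And>n. n \<le> d \<Longrightarrow> A (u n) - scale (th n) (u n) \<in> span (u ` {..<n})"
    and Bu: "\<And>n. n \<le> d \<Longrightarrow> B (u n) = scale (ths (d - n)) (u n)
          + (if n < d then scale (g (d - n)) (u (Suc n)) else 0)"
    using flip[OF 2] by auto
  obtain w where w: "basis scale d w" and Aw: "\<And>n. n \<le> d \<Longrightarrow> A (w n) = scale (th n) (w n)"
    using triangular_eigenbasis[OF u lin(1) Au th] by blast
  let ?w = "\<lambda>n. w (d - n)"
  obtain u' where u': "basis scale d u'"
    and Au': "\<And>n. n \<le> d \<Longrightarrow> A (u' n) - scale (th (d - n)) (u' n) \<in> span (u' ` {..<n})"
    and Bu': "\<And>n. n \<le> d \<Longrightarrow> B (u' n) = scale (ths (d - n)) (u' n)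
          + (if n < d then scale (f (d - n)) (u' (Suc n)) else 0)"
    using flip[OF 1] by auto
  have th': "inj_on (\<lambda>n. th (d - n)) {..d}"
  proof (rule inj_onI)
    fix i j assume "i \<in> {..d}" "j \<in> {..d}" "th (d - i) = th (d - j)"
    then have "d - i = d - j" using th by (auto dest: inj_onD)
    then show "i = j" using \<open>i \<in> {..d}\<close> \<open>j \<in> {..d}\<close> by auto
  qed
  have Aw': "A (?w n) = scale (th (d - n)) (?w n)" if "n \<le> d" for n by (simp add: Aw)
  have coord_rev: "coord d ?w (d - i) x = coord d w i x" if "i \<le> d" for i x
  proof -
    have "n \<in> (\<lambda>n. d - n) ` {..d}" if "n \<le> d" for n
      by (rule image_eqI[of _ _ "d - n"]) (use that in auto)
    then have "(\<lambda>n. d - n) ` {..d} = {..d}" by auto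
    then have "?w ` {..d} = w ` {..d}" by (metis image_image)
    then show ?thesis using that by (simp add: coord_def)
  qed
  let ?M = "mat (d + 1) (d + 1) (\<lambda>(i, n). coord d w i (A (w n)))"
  let ?N = "mat (d + 1) (d + 1) (\<lambda>(i, n). coord d w i (B (w n)))"
  have "diagonal_mat ?M"
    unfolding diagonal_mat_def by (auto simp: Aw coord_scale[OF w] coord_basis[OF w])
  moreover have "irred_tridiagonal ?N"
  proof -
    have "coord d w i (B (w n)) = 0" if "n \<le> d" "i \<le> d" "Suc n < i" for i n
      by (rule split_basis_raises_eigenvector(1)[OF u lin Au th Bu _ w Aw that]) (use g in auto)
    moreover have "coord d w (Suc n) (B (w n)) \<noteq> 0" if "n < d" for n
      by (rule split_basis_raises_eigenvector(2)[OF u lin Au th Bu _ w Aw that]) (use g in auto)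
    moreover have "coord d w i (B (w n)) = 0" if "n \<le> d" "i \<le> d" "Suc i < n" for i n
    proof -
      have "coord d ?w (d - i) (B (?w (d - n))) = 0"
        by (rule split_basis_raises_eigenvector(1)[OF u' lin Au' th' Bu' _ basis_reverse[OF w] Aw'])
          (use f that in auto)
      then show ?thesis using coord_rev[of i "B (w n)"] that by simp
    qed
    moreover have "coord d w i (B (w (Suc i))) \<noteq> 0" if "i < d" for i
    proof -
      have "coord d ?w (Suc (d - Suc i)) (B (?w (d - Suc i))) \<noteq> 0"
        by (rule split_basis_raises_eigenvector(2)[OF u' lin Au' th' Bu' _ basis_reverse[OF w] Aw'])
          (use f that in auto)
      then show ?thesis using coord_rev[of i "B (w (Suc i))"] that by (simp add: Suc_diff_Suc)
    qed
    ultimately show ?thesis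
      unfolding irred_tridiagonal_def by auto
  qed
  ultimately show ?thesis
    using w represents_coord[OF w lin(1)] represents_coord[OF w lin(2)] by blast
qed

end

section \<open>The scalars of the split forms\<close>

lemma power_int_double: "x powi (2 * k) = (x powi k)\<^sup>2" for x :: "'a::field"
  by (simp add: power_int_mult mult.commute[of 2])

lemmas powi_expand = power_int_add power_int_diff power_int_minus power_int_double

text \<open>
  The scalars of the split forms as rational functions of \<open>D = q\<^bsup>d\<^esup>\<close> and \<open>z = q\<^bsup>n\<^esup>\<close>. In this form the
  identities that drive the induction over \<open>n\<close>, where \<open>z\<close> becomes \<open>q z\<close>, hold for arbitrary nonzero
  values of the variables.
\<close>

definition theta_at :: "'a::field \<Rightarrow> 'a \<Rightarrow> 'a \<Rightarrow> 'a" where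
  "theta_at D s z = s * z\<^sup>2 / D + D / (s * z\<^sup>2)"

definition varphi_at :: "'a::field \<Rightarrow> 'a \<Rightarrow> 'a \<Rightarrow> 'a \<Rightarrow> 'a \<Rightarrow> 'a \<Rightarrow> 'a" where
  "varphi_at q D a b c z = q * D / (a * b) * (z - 1 / z) * (z / (q * D) - q * D / z)
     * (1 / z - a * b * c * z / (q * D)) * (1 / z - a * b / c * z / (q * D))"

text \<open>
  The diagonal coefficient of the third operator \<open>C\<close> in the split basis. It solves the recursion
  \<open>beta_at_shift\<close> with the initial value \<open>beta_at_1\<close>.
\<close>

definition beta_at :: "'a::field \<Rightarrow> 'a \<Rightarrow> 'a \<Rightarrow> 'a \<Rightarrow> 'a \<Rightarrow> 'a \<Rightarrow> 'a" where
  "beta_at q D a b c z = ((c + 1 / c) * D + (1 / q + q * D\<^sup>2) / (a * b)) / z\<^sup>2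
     - D\<^sup>2 * (q\<^sup>2 + 1) / (q * a * b * z ^ 4)"

text \<open>
  The right-hand side of the \<open>\<int>\<^sub>3\<close>-symmetric equations up to the factor \<open>q + q\<^sup>-\<^sup>1\<close>, for \<open>D = q\<^bsup>d\<^esup>\<close>.
\<close>

definition askey_const :: "'a::field \<Rightarrow> 'a \<Rightarrow> 'a \<Rightarrow> 'a \<Rightarrow> 'a \<Rightarrow> 'a" where
  "askey_const q D a b c = (a + 1 / a) * (q * D + 1 / (q * D)) + (b + 1 / b) * (c + 1 / c)"

lemma theta_eq_theta_at: "q \<noteq> 0 \<Longrightarrow> theta q d s n = theta_at (q ^ d) s (q ^ n)"
  by (simp add: theta_def theta_at_def powi_expand divide_inverse)

lemma varphi_eq_varphi_at: "q \<noteq> 0 \<Longrightarrow> varphi q a b c d n = varphi_at q (q ^ d) a b c (q ^ n)"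
  by (simp add: varphi_def varphi_at_def powi_expand divide_inverse mult_ac)

context
  fixes q D a b c z :: "'a::field"
  assumes nz: "q \<noteq> 0" "D \<noteq> 0" "a \<noteq> 0" "b \<noteq> 0" "c \<noteq> 0" "z \<noteq> 0"
begin

lemma beta_at_1:
  "beta_at q D a b c 1
    = (c + 1 / c) * D + (a + 1 / a) / (q * b) - D / (q * b) * theta_at D a 1"
  using nz unfolding theta_at_def varphi_at_def beta_at_def askey_const_def
  by (simp add: field_simps power2_eq_square power4_eq_xxxx)

lemma theta_at_shift:
  "theta_at D b (q * z) = q\<^sup>2 * theta_at D b z - q * (q\<^sup>2 - 1 / q\<^sup>2) * (D / (q * b * z\<^sup>2))"
  using nz unfolding theta_at_def varphi_at_def beta_at_def askey_const_def
  by (simp add: field_simps power2_eq_square power4_eq_xxxx)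

lemma varphi_at_shift:
  "varphi_at q D a b c (q * z) = q\<^sup>2 * (varphi_at q D a b c z + theta_at D b z * theta_at D a z)
    + q * (q\<^sup>2 - 1 / q\<^sup>2) * beta_at q D a b c z
    - (q\<^sup>2 - 1) * askey_const q D c a b - theta_at D a z * theta_at D b z"
  using nz unfolding theta_at_def varphi_at_def beta_at_def askey_const_def
  by (simp add: field_simps power2_eq_square power4_eq_xxxx)

lemma varphi_at_cancel:
  "q\<^sup>2 * ph * theta_at D a (z / q) - q * (q\<^sup>2 - 1 / q\<^sup>2) * (q * D * ph / (a * z\<^sup>2)) - theta_at D a z * ph = 0"
  using nz unfolding theta_at_def varphi_at_def beta_at_def askey_const_def
  by (simp add: field_simps power2_eq_square power4_eq_xxxx)

lemma beta_at_shift: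
  "beta_at q D a b c (q * z)
    = (beta_at q D a b c z - (D / (q * b * z\<^sup>2)) * theta_at D a (q * z)) / q\<^sup>2 + theta_at D a z * (D / (q * b * z\<^sup>2))"
  using nz unfolding theta_at_def varphi_at_def beta_at_def askey_const_def
  by (simp add: field_simps power2_eq_square power4_eq_xxxx)

lemma gamma_shift:
  "- (q * D * varphi_at q D a b c (q * z) / (a * (q * z)\<^sup>2))
    = (beta_at q D a b c z * theta_at D a z - (q * D * varphi_at q D a b c z / (a * z\<^sup>2))) / q\<^sup>2
      + (q\<^sup>2 - 1) / q\<^sup>2 * askey_const q D b c a - (q\<^sup>2 - 1 / q\<^sup>2) / q * theta_at D b z - theta_at D a z * beta_at q D a b c z"
  using nz unfolding theta_at_def varphi_at_def beta_at_def askey_const_def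
  by (simp add: field_simps power2_eq_square power4_eq_xxxx)

lemma gamma_cancel:
  "- (q * D * ph / (a * z\<^sup>2)) * theta_at D a (z / q) / q\<^sup>2 - (q\<^sup>2 - 1 / q\<^sup>2) / q * ph + theta_at D a z * (q * D * ph / (a * z\<^sup>2)) = 0"
  using nz unfolding theta_at_def varphi_at_def beta_at_def askey_const_def
  by (simp add: field_simps power2_eq_square power4_eq_xxxx)

end

context coord_space
begin

text \<open>
  The tool for all computations with words in the operators: after applying a functional, an identity of
  vectors becomes an identity in the field, in which the values on the different words are
  indeterminates.
\<close>

lemma eq_if_functionals_eq:
  assumes "basis scale d v"
    and "\<And>p. Vector_Spaces.linear scale (*) p \<Longrightarrow> p x = p y"
  shows "x = y"
  using assms linear_coord by (intro eq_if_coord_eq[OF assms(1)]) blast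

lemma functional_simps:
  assumes "Vector_Spaces.linear scale (*) p"
  shows "p (x + y) = p x + p y" "p (x - y) = p x - p y" "p (scale r x) = r * p x"
  using assms by (auto simp: Vector_Spaces.linear_def module_hom.add module_hom.diff module_hom.scale)

text \<open>
  A \<open>\<int>\<^sub>3\<close>-symmetric equation as a rule for moving one operator past another.
\<close>

lemma Z3_swap:
  assumes v: "basis scale d v" and q: "q \<noteq> 0" "q ^ 4 \<noteq> 1"
    and Z: "Z3_equation q scale d a b c A B C"
  shows "C (B x) = scale (q\<^sup>2) (B (C x)) + scale (q * (q\<^sup>2 - 1 / q\<^sup>2)) (A x)
      - scale ((q\<^sup>2 - 1) * askey_const q (q ^ d) a b c) x" 
proof (rule eq_if_functionals_eq[OF v])
  fix p assume "Vector_Spaces.linear scale (*) p"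
  note p = functional_simps[OF this]
  define N where "N = askey_const q (q ^ d) a b c"
  define w where "w = q\<^sup>2 - 1 / q\<^sup>2"
  have "q ^ 4 - 1 = (q\<^sup>2 - 1) * (q\<^sup>2 + 1)" by (simp add: algebra_simps power2_eq_square power4_eq_xxxx)
  with q have q2: "q\<^sup>2 - 1 \<noteq> 0" "q\<^sup>2 + 1 \<noteq> 0" by auto
  have w: "w = (q\<^sup>2 - 1) * (q\<^sup>2 + 1) / q\<^sup>2"
    using q by (simp add: w_def field_simps)
  have N: "((a + inverse a) * (q ^ (d + 1) + inverse (q ^ (d + 1)))
      + (b + inverse b) * (c + inverse c)) = N"
    by (simp add: N_def askey_const_def divide_inverse)
  have "p (A x) + 1 / w * (q * p (B (C x)) - inverse q * p (C (B x)))
      = N / (q + inverse q) * p x"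
    using arg_cong[OF Z[unfolded Z3_equation_def, rule_format, of x], of p]
    unfolding N by (simp add: p w_def divide_inverse)
  moreover have "q + inverse q = (q\<^sup>2 + 1) / q"
    using q by (simp add: field_simps power2_eq_square)
  ultimately have *: "p (A x) + 1 / w * (q * p (B (C x)) - inverse q * p (C (B x)))
      = N * q / (q\<^sup>2 + 1) * p x" by simp
  have "w \<noteq> 0" using w q q2 by simp
  then have "p (C (B x)) = q\<^sup>2 * p (B (C x)) + q * w * p (A x)
      - q * w * (p (A x) + 1 / w * (q * p (B (C x)) - inverse q * p (C (B x))))"
    using q by (simp add: algebra_simps power2_eq_square)
  also have "\<dots> = q\<^sup>2 * p (B (C x)) + q * w * p (A x) - w * q\<^sup>2 / (q\<^sup>2 + 1) * N * p x"
    unfolding * by (simp add: power2_eq_square mult_ac)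
  also have "w * q\<^sup>2 / (q\<^sup>2 + 1) = q\<^sup>2 - 1" using q q2 by (simp add: w)
  finally show "p (C (B x)) = p (scale (q\<^sup>2) (B (C x)) + scale (q * (q\<^sup>2 - 1 / q\<^sup>2)) (A x)
      - scale ((q\<^sup>2 - 1) * askey_const q (q ^ d) a b c) x)"
    by (simp add: p w_def N_def)
qed

text \<open>
  The claim about \<open>C\<close> is needed for the induction to close: the equations express \<open>B A\<close> through \<open>A B\<close> and
  \<open>C\<close>, and \<open>C A\<close> through \<open>A C\<close> and \<open>B\<close>. Comparing coefficients dictates the shape of the action of
  \<open>C\<close>, and the remaining consistency conditions are the identities for \<open>theta_at\<close>, \<open>varphi_at\<close> and
  \<open>beta_at\<close> above. For \<open>n = 0\<close> the truncated index \<open>n - 1\<close> is harmless, as \<open>varphi\<close> vanishes there.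
\<close>

lemma split_recursion:
  assumes v: "basis scale d v" and q: "q \<noteq> 0" "q ^ 4 \<noteq> 1" and nz: "a \<noteq> 0" "b \<noteq> 0" "c \<noteq> 0"
    and lin: "Vector_Spaces.linear scale scale A" "Vector_Spaces.linear scale scale B"
      "Vector_Spaces.linear scale scale C"
    and ZB: "Z3_equation q scale d b c a B C A" and ZC: "Z3_equation q scale d c a b C A B"
    and Bu0: "B (u 0) = scale (theta q d b 0) (u 0)"
    and Cu0: "C (u 0) + scale (q ^ d / (q * b)) (A (u 0))
       = scale ((c + 1 / c) * q ^ d + (a + 1 / a) / (q * b)) (u 0)"
    and u: "\<And>n. u (Suc n) = A (u n) - scale (theta q d a n) (u n)"
  shows "B (u n) = scale (theta q d b n) (u n) + scale (varphi q a b c d n) (u (n - 1)) \<and>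
    C (u n) = scale (- (q ^ d / (q * b * (q ^ n)\<^sup>2))) (u (Suc n)) + scale (beta_at q (q ^ d) a b c (q ^ n)) (u n)
      + scale (- (q * q ^ d * varphi q a b c d n / (a * (q ^ n)\<^sup>2))) (u (n - 1))"
proof (induction n)
  interpret A: Vector_Spaces.linear scale scale A by fact
  interpret B: Vector_Spaces.linear scale scale B by fact
  interpret C: Vector_Spaces.linear scale scale C by fact
  case 0
  have "varphi q a b c d 0 = 0" by (simp add: varphi_def)
  moreover have "C (u 0) = scale (- (q ^ d / (q * b * (q ^ 0)\<^sup>2))) (u (Suc 0)) + scale (beta_at q (q ^ d) a b c 1) (u 0)"
  proof (rule eq_if_functionals_eq[OF v])
    fix p assume "Vector_Spaces.linear scale (*) p"
    note p = functional_simps[OF this]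
    have "p (C (u 0)) + q ^ d / (q * b) * p (A (u 0))
       = ((c + 1 / c) * q ^ d + (a + 1 / a) / (q * b)) * p (u 0)"
      using arg_cong[OF Cu0, of p] by (simp add: p)
    then have pC: "p (C (u 0)) = ((c + 1 / c) * q ^ d + (a + 1 / a) / (q * b)) * p (u 0)
        - q ^ d / (q * b) * p (A (u 0))" by (simp add: algebra_simps)
    have "beta_at q (q ^ d) a b c 1 = (c + 1 / c) * q ^ d + (a + 1 / a) / (q * b)
        - q ^ d / (q * b) * theta q d a 0"
      using beta_at_1[of q "q ^ d" a b c 1] q nz by (simp add: theta_eq_theta_at)
    then show "p (C (u 0)) = p (scale (- (q ^ d / (q * b * (q ^ 0)\<^sup>2))) (u (Suc 0)) 
        + scale (beta_at q (q ^ d) a b c 1) (u 0))"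
      by (simp add: u p pC right_diff_distrib left_diff_distrib diff_divide_distrib mult_ac)
  qed
  ultimately show ?case using Bu0 by simp
next
  interpret A: Vector_Spaces.linear scale scale A by fact
  interpret B: Vector_Spaces.linear scale scale B by fact
  interpret C: Vector_Spaces.linear scale scale C by fact
  case (Suc n)
  define D z where "D = q ^ d" and "z = q ^ n"
  have D: "D \<noteq> 0" and z: "z \<noteq> 0" using q by (auto simp: D_def z_def)
  note nonzero = q(1) D nz z
  define w where "w = q\<^sup>2 - 1 / q\<^sup>2"
  define th ts ph be where "th = theta_at D a z" and "ts = theta_at D b z"
    and "ph = varphi_at q D a b c z" and "be = beta_at q D a b c z"
  define al ga where "al = D / (q * b * z\<^sup>2)" and "ga = q * D * ph / (a * z\<^sup>2)"
  \<comment> \<open>the eigenvalue with index n - 1, as a rational function that makes sense also for n = 0\<close>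
  define thp where "thp = theta_at D a (z / q)"
  define th' ts' ph' be' where "th' = theta_at D a (q * z)" and "ts' = theta_at D b (q * z)"
    and "ph' = varphi_at q D a b c (q * z)" and "be' = beta_at q D a b c (q * z)"
  define al' ga' where "al' = D / (q * b * (q * z)\<^sup>2)" and "ga' = q * D * ph' / (a * (q * z)\<^sup>2)"
  have theta: "theta q d a n = th" "theta q d a (Suc n) = th'" "theta q d b n = ts"
      "theta q d b (Suc n) = ts'" "varphi q a b c d n = ph" "varphi q a b c d (Suc n) = ph'"
    unfolding theta_eq_theta_at[OF q(1)] varphi_eq_varphi_at[OF q(1)]
    by (simp_all add: th_def th'_def ts_def ts'_def ph_def ph'_def D_def z_def)
  define x y r s where "x = u (n - 1)" and "y = u n" and "r = u (Suc n)" and "s = u (Suc (Suc n))"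
  have Ax: "scale ph (A x) = scale ph y + scale (ph * thp) x"
  proof (cases n)
    case 0
    then show ?thesis using theta(5) by (simp add: varphi_def)
  next
    case (Suc m)
    have "theta q d a m = thp"
      using q by (simp add: theta_eq_theta_at thp_def D_def z_def Suc)
    then have "A x = y + scale thp x" using u[of m] by (simp add: x_def y_def Suc)
    then show ?thesis by (simp add: scale_right_distrib)
  qed
  have Ay: "A y = r + scale th y" using u[of n] theta by (simp add: r_def y_def)
  have Ar: "A r = s + scale th' r" using u[of "Suc n"] theta by (simp add: r_def s_def)
  have By: "B y = scale ts y + scale ph x"
    and Cy: "C y = scale (- al) r + scale be y + scale (- ga) x"
    using Suc theta by (simp_all add: y_def x_def r_def be_def al_def ga_def D_def z_def)
  have BA: "B (A y) = scale (q\<^sup>2) (A (B y)) + scale (q * w) (C y)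
      - scale ((q\<^sup>2 - 1) * askey_const q D c a b) y"
    unfolding w_def D_def by (rule Z3_swap[OF v q ZC])
  have AC: "A (C y) = scale (q\<^sup>2) (C (A y)) + scale (q * w) (B y)
      - scale ((q\<^sup>2 - 1) * askey_const q D b c a) y"
    unfolding w_def D_def by (rule Z3_swap[OF v q ZB])
  have phx: "ph * p (A x) = ph * p y + ph * thp * p x"
    and gax: "ga * p (A x) = ga * p y + ga * thp * p x"
    if "Vector_Spaces.linear scale (*) p" for p
  proof -
    note p = functional_simps[OF that]
    show *: "ph * p (A x) = ph * p y + ph * thp * p x"
      using arg_cong[OF Ax, of p] by (simp add: p)
    obtain k where ga: "ga = k * ph" by (auto simp: ga_def intro: that[of "q * D / (a * z\<^sup>2)"])
    have "k * (ph * p (A x)) = k * (ph * p y + ph * thp * p x)" unfolding * ..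
    then show "ga * p (A x) = ga * p y + ga * thp * p x"
      unfolding ga by (simp only: distrib_left mult.assoc)
  qed
  have Br: "B r = scale ts' r + scale ph' y"
  proof (rule eq_if_functionals_eq[OF v])
    fix p assume lin_p: "Vector_Spaces.linear scale (*) p"
    note p = functional_simps[OF lin_p]
    have "p (B r) = p (B (A y)) - th * p (B y)"
      using Ay by (simp add: B.add B.scale p)
    also have "\<dots> = q\<^sup>2 * (ts * (p r + th * p y) + ph * p (A x)) + q * w * p (C y)
        - (q\<^sup>2 - 1) * askey_const q D c a b * p y - th * p (B y)"
      unfolding BA by (simp add: By p A.add A.scale Ay)
    also have "\<dots> = (q\<^sup>2 * ts - q * w * al) * p r
       + (q\<^sup>2 * (ph + ts * th) + q * w * be - (q\<^sup>2 - 1) * askey_const q D c a b - th * ts) * p y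
       + (q\<^sup>2 * ph * thp - q * w * ga - th * ph) * p x"
      unfolding phx[OF lin_p] By Cy p by (simp add: ring_distribs mult_ac)
    finally show "p (B r) = p (scale ts' r + scale ph' y)"
      using theta_at_shift[OF nonzero] varphi_at_shift[OF nonzero] varphi_at_cancel[OF nonzero, of ph]
      unfolding th_def[symmetric] ts_def[symmetric] ph_def[symmetric] be_def[symmetric] al_def[symmetric]
        ga_def[symmetric] thp_def[symmetric] w_def[symmetric] ts'_def[symmetric] ph'_def[symmetric]
      by (simp add: p)
  qed
  have Cr: "C r = scale (- al') s + scale be' r + scale (- ga') y"
  proof (rule eq_if_functionals_eq[OF v])
    fix p assume lin_p: "Vector_Spaces.linear scale (*) p"
    note p = functional_simps[OF lin_p]
    have pAC: "p (A (C y)) = q\<^sup>2 * p (C (A y)) + q * w * p (B y) - (q\<^sup>2 - 1) * askey_const q D b c a * p y"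
      unfolding AC by (simp add: p)
    have CA: "p (C (A y)) = p (A (C y)) / q\<^sup>2 - w / q * p (B y)
        + (q\<^sup>2 - 1) / q\<^sup>2 * askey_const q D b c a * p y"
      unfolding pAC using q by (simp add: field_simps power2_eq_square)
    have "p (C r) = p (C (A y)) - th * p (C y)"
      using Ay by (simp add: C.add C.scale p)
    also have "\<dots> = (- al * (p s + th' * p r) + be * (p r + th * p y) - ga * p (A x)) / q\<^sup>2
        - w / q * p (B y) + (q\<^sup>2 - 1) / q\<^sup>2 * askey_const q D b c a * p y - th * p (C y)"
      unfolding CA Cy by (simp add: p A.add A.diff A.scale Ay Ar)
    also have "\<dots> = - (al / q\<^sup>2) * p s
       + ((be - al * th') / q\<^sup>2 + th * al) * p r
       + ((be * th - ga) / q\<^sup>2 + (q\<^sup>2 - 1) / q\<^sup>2 * askey_const q D b c a - w / q * ts - th * be) * p y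
       + (- ga * thp / q\<^sup>2 - w / q * ph + th * ga) * p x"
      unfolding gax[OF lin_p] By Cy p
      by (simp add: ring_distribs mult_ac divide_inverse)
    also have "al / q\<^sup>2 = al'" using q by (simp add: al_def al'_def power_mult_distrib mult_ac)
    finally show "p (C r) = p (scale (- al') s + scale be' r + scale (- ga') y)"
      using beta_at_shift[OF nonzero] gamma_shift[OF nonzero] gamma_cancel[OF nonzero, of ph]
      unfolding th_def[symmetric] ts_def[symmetric] ph_def[symmetric] be_def[symmetric] al_def[symmetric]
        ga_def[symmetric] thp_def[symmetric] w_def[symmetric] be'_def[symmetric] ph'_def[symmetric]
        th'_def[symmetric] ga'_def[symmetric]
      by (simp add: p)
  qed
  from Br Cr show ?case
    unfolding theta by (simp add: r_def y_def s_def be'_def al'_def ga'_def D_def z_def)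
qed

end

text \<open>
  Two coinciding values for \<open>m \<noteq> n\<close> force \<open>s\<^sup>2 = q\<^bsup>2(d-m-n)\<^esup>\<close>, and then \<open>0 < m + n < 2d\<close>.
\<close>

lemma feasible_theta_inj:
  assumes q: "q \<noteq> 0" and "s \<noteq> 0"
    and s: "\<And>k. 1 - int d \<le> k \<Longrightarrow> k \<le> int d - 1 \<Longrightarrow> s\<^sup>2 \<noteq> q powi (2 * k)"
    and inj: "\<And>i j. q powi i = q powi j \<longleftrightarrow> i = j"
  shows "inj_on (theta q d s) {..d}"
proof (rule inj_onI, rule ccontr)
  fix m n assume mn: "m \<in> {..d}" "n \<in> {..d}" "theta q d s m = theta q d s n" "m \<noteq> n"
  define x y where "x = q powi (2 * int m - int d)" and "y = q powi (2 * int n - int d)"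
  have nz: "x \<noteq> 0" "y \<noteq> 0" using q by (simp_all add: x_def y_def)
  have inv: "q powi (int d - 2 * int k) = 1 / q powi (2 * int k - int d)" for k
    using power_int_minus[of q "2 * int k - int d"] by (simp add: divide_inverse)
  have "s * x + 1 / (s * x) = s * y + 1 / (s * y)"
    using mn(3) by (simp add: theta_def inv x_def y_def divide_inverse)
  then have "s * ((x - y) * (s\<^sup>2 * (x * y) - 1)) = 0"
    using nz \<open>s \<noteq> 0\<close> by (simp add: field_simps power2_eq_square)
  then have "(x - y) * (s\<^sup>2 * (x * y) - 1) = 0" using \<open>s \<noteq> 0\<close> by simp
  moreover have "x \<noteq> y" unfolding x_def y_def inj using mn(4) by auto
  ultimately have "s\<^sup>2 * (x * y) = 1" by simp
  then have "s\<^sup>2 = 1 / (x * y)" using nz by (simp add: eq_divide_eq)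
  also have "x * y = q powi (2 * (int m + int n - int d))"
    using q by (simp add: x_def y_def algebra_simps flip: power_int_add)
  also have "1 / \<dots> = q powi (2 * (int d - int m - int n))"
    using power_int_minus[of q "2 * (int m + int n - int d)"] by (simp add: divide_inverse algebra_simps)
  finally show False using s[of "int d - int m - int n"] mn by auto
qed

lemma feasible_swap: "feasible q a b c d \<longleftrightarrow> feasible q b a c d"
  by (auto simp: feasible_def mult_ac)

section \<open>Evaluation modules\<close>

definition (in coord_space) weighted_sum :: "'a \<Rightarrow> ('v \<Rightarrow> 'v) \<Rightarrow> ('v \<Rightarrow> 'v) \<Rightarrow> 'v \<Rightarrow> 'v" where
  "weighted_sum s x y z = scale s (x z) + scale (1 / s) (y z)"

text \<open>
  The completions in the form without a commutator: since \<open>q x y - q\<^sup>-\<^sup>1 y x = q - q\<^sup>-\<^sup>1\<close>, the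
  commutator of \<open>x\<close> and \<open>y\<close> divided by \<open>q - q\<^sup>-\<^sup>1\<close> is \<open>q (1 - x y)\<close>.
\<close>

definition (in coord_space) completion_op :: "'a \<Rightarrow> 'a \<Rightarrow> ('v \<Rightarrow> 'v) \<Rightarrow> ('v \<Rightarrow> 'v) \<Rightarrow> 'v \<Rightarrow> 'v" where
  "completion_op r c x y z = scale c (x z) + scale (1 / c) (y z) + scale r (z - x (y z))"

text \<open>
  The relation \<open>(q x y - q\<^sup>-\<^sup>1 y x) / (q - q\<^sup>-\<^sup>1) = 1\<close>, solved for \<open>y x\<close>.
\<close>

definition (in coord_space) q_weyl :: "'a \<Rightarrow> ('v \<Rightarrow> 'v) \<Rightarrow> ('v \<Rightarrow> 'v) \<Rightarrow> bool" where
  "q_weyl q x y \<longleftrightarrow> (\<forall>z. y (x z) = scale (q\<^sup>2) (x (y z)) - scale (q\<^sup>2 - 1) z)"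

text \<open>
  Extending a basis by zero vectors makes formulas for bidiagonal and tridiagonal actions hold for all
  integer indices, without exceptions at the two ends.
\<close>

definition (in coord_space) padded :: "nat \<Rightarrow> (nat \<Rightarrow> 'v) \<Rightarrow> int \<Rightarrow> 'v" where
  "padded d v k = (if 0 \<le> k \<and> k \<le> int d then v (nat k) else 0)"

text \<open>
  The assumptions \<open>prod02\<close>, \<open>prod20\<close>, \<open>prod13\<close> and \<open>prod31\<close> are the Casimir relations, solved for the
  products of opposite generators.
\<close>

locale evaluation_module = coord_space scale
  for scale :: "'a::field \<Rightarrow> 'v::ab_group_add \<Rightarrow> 'v" +
  fixes q t :: 'a and d :: nat and x0 x1 x2 x3 :: "'v \<Rightarrow> 'v" and v :: "nat \<Rightarrow> 'v"
  assumes q_nz: "q \<noteq> 0" and q_not_root: "\<And>n::nat. n \<ge> 1 \<Longrightarrow> q ^ n \<noteq> 1" and t_nz: "t \<noteq> 0"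
    and t_generic: "\<And>n. 1 \<le> n \<Longrightarrow> n \<le> d \<Longrightarrow> t \<noteq> q powi (int d - 2 * int n + 1)"
    and linear: "Vector_Spaces.linear scale scale x0" "Vector_Spaces.linear scale scale x1"
      "Vector_Spaces.linear scale scale x2" "Vector_Spaces.linear scale scale x3"
    and weyl: "q_weyl q x0 x1" "q_weyl q x1 x2" "q_weyl q x2 x3" "q_weyl q x3 x0"
    and prod02: "x0 (x2 z) = z + scale (1 / t)
        (scale (q * q ^ d + 1 / (q * q ^ d)) z - scale q (x3 z) - scale (1 / q) (x1 z))"
    and prod20: "x2 (x0 z) = z + scale (1 / t)
        (scale (q * q ^ d + 1 / (q * q ^ d)) z - scale q (x1 z) - scale (1 / q) (x3 z))"
    and prod13: "x1 (x3 z) = z + scale t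
        (scale (q * q ^ d + 1 / (q * q ^ d)) z - scale q (x0 z) - scale (1 / q) (x2 z))"
    and prod31: "x3 (x1 z) = z + scale t
        (scale (q * q ^ d + 1 / (q * q ^ d)) z - scale q (x2 z) - scale (1 / q) (x0 z))"
    and basis_v: "basis scale d v"
    and x2_v: "\<And>n. n \<le> d \<Longrightarrow> x2 (v n) = scale (q powi (int d - 2 * int n)) (v n)"
begin

abbreviation \<Lambda> :: 'a where "\<Lambda> \<equiv> q * q ^ d + 1 / (q * q ^ d)"

lemma q_powi_inj: "q powi i = q powi j \<longleftrightarrow> i = j"
proof
  assume eq: "q powi i = q powi j"
  have *: "m = n" if "m \<le> n" "q powi m = q powi n" for m n
  proof (rule ccontr)
    assume "m \<noteq> n"
    then have "nat (n - m) \<ge> 1" using that by auto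
    moreover have "q ^ nat (n - m) = q powi (n - m)" using that by (simp add: power_int_def)
    moreover have "q powi (n - m) = 1" using that q_nz by (simp add: power_int_diff)
    ultimately show False using q_not_root by metis
  qed
  show "i = j" using *[of i j] *[of j i] eq by (cases "i \<le> j") auto
qed simp

lemma q_facts: "q ^ 4 \<noteq> 1" "q\<^sup>2 \<noteq> 1" "q - 1 / q \<noteq> 0" "q\<^sup>2 - 1 / q\<^sup>2 \<noteq> 0"
proof -
  show "q ^ 4 \<noteq> 1" and 2: "q\<^sup>2 \<noteq> 1" using q_not_root[of 4] q_not_root[of 2] by auto
  then show "q - 1 / q \<noteq> 0" "q\<^sup>2 - 1 / q\<^sup>2 \<noteq> 0"
    using q_nz by (auto simp: field_simps power2_eq_square power4_eq_xxxx)
qed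

interpretation X0: Vector_Spaces.linear scale scale x0 by (rule linear)
interpretation X1: Vector_Spaces.linear scale scale x1 by (rule linear)
interpretation X2: Vector_Spaces.linear scale scale x2 by (rule linear)
interpretation X3: Vector_Spaces.linear scale scale x3 by (rule linear)

lemmas lin_simps = X0.add X0.diff X0.scale X0.zero X1.add X1.diff X1.scale X1.zero
  X2.add X2.diff X2.scale X2.zero X3.add X3.diff X3.scale X3.zero

lemma weyl_swap: "x1 (x0 z) = scale (q\<^sup>2) (x0 (x1 z)) - scale (q\<^sup>2 - 1) z"
  "x2 (x1 z) = scale (q\<^sup>2) (x1 (x2 z)) - scale (q\<^sup>2 - 1) z"
  "x3 (x2 z) = scale (q\<^sup>2) (x2 (x3 z)) - scale (q\<^sup>2 - 1) z"
  "x0 (x3 z) = scale (q\<^sup>2) (x3 (x0 z)) - scale (q\<^sup>2 - 1) z"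
  using weyl by (auto simp: q_weyl_def)

text \<open>
  Why a \<open>q\<close>-Weyl relation makes one operator bidiagonal on the eigenvectors of the other: up to the
  multiple \<open>1 / l\<close> of the eigenvector, the other operator moves to the neighbouring eigenvalue.
\<close>

lemma weyl_raise:
  assumes "q_weyl q x y" "Vector_Spaces.linear scale scale x" "Vector_Spaces.linear scale scale y"
    and z: "y z = scale l z" "l \<noteq> 0"
  shows "y (x z - scale (1 / l) z) = scale (q\<^sup>2 * l) (x z - scale (1 / l) z)"
proof (rule eq_if_functionals_eq[OF basis_v])
  interpret x: Vector_Spaces.linear scale scale x by fact
  interpret y: Vector_Spaces.linear scale scale y by fact
  fix p assume "Vector_Spaces.linear scale (*) p"
  note p = functional_simps[OF this]
  have "p (y (x z)) = q\<^sup>2 * l * p (x z) - (q\<^sup>2 - 1) * p z"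
    using assms(1) z by (simp add: q_weyl_def x.scale p)
  then show "p (y (x z - scale (1 / l) z)) = p (scale (q\<^sup>2 * l) (x z - scale (1 / l) z))"
    using z by (simp add: y.diff y.scale p) (simp add: algebra_simps)
qed

lemma weyl_lower:
  assumes "q_weyl q x y" "Vector_Spaces.linear scale scale x" "Vector_Spaces.linear scale scale y"
    and z: "x z = scale l z" "l \<noteq> 0"
  shows "x (y z - scale (1 / l) z) = scale (l / q\<^sup>2) (y z - scale (1 / l) z)"
proof (rule eq_if_functionals_eq[OF basis_v])
  interpret x: Vector_Spaces.linear scale scale x by fact
  interpret y: Vector_Spaces.linear scale scale y by fact
  fix p assume "Vector_Spaces.linear scale (*) p"
  note p = functional_simps[OF this]
  have "l * p (y z) = q\<^sup>2 * p (x (y z)) - (q\<^sup>2 - 1) * p z"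
    using assms(1) z by (metis q_weyl_def y.scale p(2,3))
  then have "p (x (y z)) = (l * p (y z) + (q\<^sup>2 - 1) * p z) / q\<^sup>2"
    using q_nz by (simp add: field_simps)
  then show "p (x (y z - scale (1 / l) z)) = p (scale (l / q\<^sup>2) (y z - scale (1 / l) z))"
    using z q_nz by (simp add: x.diff x.scale p) (simp add: field_simps)
qed

text \<open>
  No two opposite generators are next to each other in \<open>x\<^sub>3 x\<^sub>0 x\<^sub>1\<close> and \<open>x\<^sub>2 x\<^sub>3 x\<^sub>0\<close>. Exchanging two letters by
  a \<open>q\<close>-Weyl relation creates such a pair, to which a Casimir relation applies.
\<close>

lemma triple_products:
  "scale q (x3 (x0 (x1 z))) - scale (1 / q) (x1 (x3 (x0 z))) =
     scale (q - 1 / q) (x3 z + scale (t / q) (x0 (x0 z)) - scale (t / q) z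
       - scale (1 / q) (scale \<Lambda> z - scale q (x1 z) - scale (1 / q) (x3 z)))" (is ?b301)
  "scale q (x2 (x3 (x0 z))) - scale (1 / q) (x3 (x0 (x2 z))) =
     scale (q - 1 / q) (x0 z + scale (1 / (q * t)) (x3 (x3 z)) - scale (1 / (q * t)) z
       - scale (1 / q) (scale \<Lambda> z - scale q (x2 z) - scale (1 / q) (x0 z)))" (is ?b230)
proof -
  define L where "L = \<Lambda>"
  note L = L_def[symmetric]
  show ?b301
  proof (rule eq_if_functionals_eq[OF basis_v])
    fix p assume "Vector_Spaces.linear scale (*) p"
    note p = functional_simps[OF this]
    have "p (x3 (x1 (x0 z))) = q\<^sup>2 * p (x3 (x0 (x1 z))) - (q\<^sup>2 - 1) * p (x3 z)"
      unfolding weyl_swap(1) by (simp add: lin_simps p)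
    then have 1: "p (x3 (x0 (x1 z))) = (p (x3 (x1 (x0 z))) + (q\<^sup>2 - 1) * p (x3 z)) / q\<^sup>2"
      using q_nz by simp
    have 2: "p (x3 (x1 (x0 z))) = p (x0 z) + t * (L * p (x0 z) - q * p (x2 (x0 z)) - 1 / q * p (x0 (x0 z)))"
      "p (x1 (x3 (x0 z))) = p (x0 z) + t * (L * p (x0 z) - q * p (x0 (x0 z)) - 1 / q * p (x2 (x0 z)))"
      unfolding prod31 prod13 L by (simp_all add: p)
    have 3: "p (x2 (x0 z)) = p z + 1 / t * (L * p z - q * p (x1 z) - 1 / q * p (x3 z))"
      unfolding prod20 L by (simp add: p)
    show "p (scale q (x3 (x0 (x1 z))) - scale (1 / q) (x1 (x3 (x0 z))))
      = p (scale (q - 1 / q) (x3 z + scale (t / q) (x0 (x0 z)) - scale (t / q) z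
       - scale (1 / q) (scale \<Lambda> z - scale q (x1 z) - scale (1 / q) (x3 z))))"
      unfolding L p 1 2 3 using q_nz t_nz by (simp add: field_simps power2_eq_square)
  qed
  show ?b230
  proof (rule eq_if_functionals_eq[OF basis_v])
    fix p assume "Vector_Spaces.linear scale (*) p"
    note p = functional_simps[OF this]
    have "p (x3 (x2 (x0 z))) = q\<^sup>2 * p (x2 (x3 (x0 z))) - (q\<^sup>2 - 1) * p (x0 z)"
      unfolding weyl_swap(3) by (simp add: p)
    then have 1: "p (x2 (x3 (x0 z))) = (p (x3 (x2 (x0 z))) + (q\<^sup>2 - 1) * p (x0 z)) / q\<^sup>2"
      using q_nz by simp
    have 2: "p (x3 (x0 (x2 z))) = p (x3 z) + 1 / t * (L * p (x3 z) - q * p (x3 (x3 z)) - 1 / q * p (x3 (x1 z)))"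
      "p (x3 (x2 (x0 z))) = p (x3 z) + 1 / t * (L * p (x3 z) - q * p (x3 (x1 z)) - 1 / q * p (x3 (x3 z)))"
      unfolding prod02 prod20 L by (simp_all add: lin_simps p)
    have 3: "p (x3 (x1 z)) = p z + t * (L * p z - q * p (x2 z) - 1 / q * p (x0 z))"
      unfolding prod31 L by (simp add: p)
    show "p (scale q (x2 (x3 (x0 z))) - scale (1 / q) (x3 (x0 (x2 z))))
      = p (scale (q - 1 / q) (x0 z + scale (1 / (q * t)) (x3 (x3 z)) - scale (1 / (q * t)) z
       - scale (1 / q) (scale \<Lambda> z - scale q (x2 z) - scale (1 / q) (x0 z))))"
      unfolding L p 1 2 3 using q_nz t_nz by (simp add: field_simps power2_eq_square)
  qed
qed

abbreviation vv :: "int \<Rightarrow> 'v" where "vv \<equiv> padded d v"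

lemma x2_vv: "x2 (vv k) = scale (q powi (int d - 2 * k)) (vv k)"
  using x2_v[of "nat k"] by (auto simp: padded_def X2.zero)

lemma x2_eigenvector:
  assumes "x2 z = scale (q powi (int d - 2 * k)) z"
  shows "\<exists>c. z = scale c (vv k)"
proof (cases "0 \<le> k \<and> k \<le> int d")
  case True
  then have "z = scale (coord d v (nat k) z) (v (nat k))"
    by (intro eigenvector_multiple[OF basis_v linear(3) x2_v assms]) (auto simp: q_powi_inj)
  then show ?thesis using True by (auto simp: padded_def)
next
  case False
  have "z = scale 0 (vv k)"
  proof (rule eq_if_coord_eq[OF basis_v])
    fix i assume "i \<le> d"
    then have "coord d v i z = 0"
      by (intro eigenvector_coord[OF basis_v linear(3) x2_v assms]) (use False in \<open>auto simp: q_powi_inj\<close>)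
    then show "coord d v i z = coord d v i (scale 0 (vv k))" by (simp add: coord_zero[OF basis_v])
  qed
  then show ?thesis by blast
qed

lemma ex_lowering: "\<exists>e. x1 (vv k) = scale (q powi (2 * k - int d)) (vv k) + scale e (vv (k - 1))"
proof -
  have "x2 (x1 (vv k) - scale (1 / q powi (int d - 2 * k)) (vv k))
      = scale (q\<^sup>2 * q powi (int d - 2 * k)) (x1 (vv k) - scale (1 / q powi (int d - 2 * k)) (vv k))"
    by (rule weyl_raise[OF weyl(2) linear(2,3) x2_vv]) (use q_nz in simp)
  also have "q\<^sup>2 * q powi (int d - 2 * k) = q powi (int d - 2 * (k - 1))"
    using q_nz power_int_add[of q 2 "int d - 2 * k"] by (simp add: algebra_simps)
  finally obtain e where "x1 (vv k) - scale (1 / q powi (int d - 2 * k)) (vv k) = scale e (vv (k - 1))"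
    using x2_eigenvector by blast
  moreover have "1 / q powi (int d - 2 * k) = q powi (2 * k - int d)"
    using power_int_minus[of q "int d - 2 * k"] by (simp add: divide_inverse)
  ultimately show ?thesis by (intro exI[of _ e]) (simp add: algebra_simps)
qed

lemma ex_raising: "\<exists>f. x3 (vv k) = scale (q powi (2 * k - int d)) (vv k) + scale f (vv (k + 1))"
proof -
  have "x2 (x3 (vv k) - scale (1 / q powi (int d - 2 * k)) (vv k))
      = scale (q powi (int d - 2 * k) / q\<^sup>2) (x3 (vv k) - scale (1 / q powi (int d - 2 * k)) (vv k))"
    by (rule weyl_lower[OF weyl(3) linear(3,4) x2_vv]) (use q_nz in simp)
  also have "q powi (int d - 2 * k) / q\<^sup>2 = q powi (int d - 2 * (k + 1))"
    using q_nz power_int_diff[of q "int d - 2 * k" 2] by (simp add: algebra_simps)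
  finally obtain f where "x3 (vv k) - scale (1 / q powi (int d - 2 * k)) (vv k) = scale f (vv (k + 1))"
    using x2_eigenvector by blast
  moreover have "1 / q powi (int d - 2 * k) = q powi (2 * k - int d)"
    using power_int_minus[of q "int d - 2 * k"] by (simp add: divide_inverse)
  ultimately show ?thesis by (intro exI[of _ f]) (simp add: algebra_simps)
qed

text \<open>
  The off-diagonal coefficients of \<open>x\<^sub>1\<close> and \<open>x\<^sub>3\<close> on the eigenbasis of \<open>x\<^sub>2\<close>. They depend on the
  normalization of this basis; only the products \<open>low k * up (k - 1)\<close> are intrinsic.
\<close>

definition low :: "int \<Rightarrow> 'a" where
  "low k = (SOME e. x1 (vv k) = scale (q powi (2 * k - int d)) (vv k) + scale e (vv (k - 1)))"

definition up :: "int \<Rightarrow> 'a" where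
  "up k = (SOME f. x3 (vv k) = scale (q powi (2 * k - int d)) (vv k) + scale f (vv (k + 1)))"

lemma x1_vv: "x1 (vv k) = scale (q powi (2 * k - int d)) (vv k) + scale (low k) (vv (k - 1))"
  unfolding low_def by (rule someI_ex[OF ex_lowering])

lemma x3_vv: "x3 (vv k) = scale (q powi (2 * k - int d)) (vv k) + scale (up k) (vv (k + 1))"
  unfolding up_def by (rule someI_ex[OF ex_raising])

lemma coord_vv: "i \<le> d \<Longrightarrow> coord d v i (vv k) = (if k = int i then 1 else 0)"
  by (auto simp: padded_def coord_basis[OF basis_v] coord_zero[OF basis_v])

text \<open>
  The diagonal coefficients of \<open>x\<^sub>3 x\<^sub>1\<close> and \<open>x\<^sub>1 x\<^sub>3\<close> contain the \<open>n\<close>-th and the \<open>(n+1)\<close>-st product; the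
  two Casimir relations for these words permit eliminating \<open>x\<^sub>0\<close>.
\<close>

lemma low_up_recursion:
  assumes "n \<le> d"
  shows "low (int n + 1) * up (int n) = q\<^sup>2 * (low (int n) * up (int n - 1))
    + (q\<^sup>2 - 1) * ((q ^ n) ^ 4 / (q ^ d)\<^sup>2 - 1)
    + t * (q * (q\<^sup>2 - 1 / q\<^sup>2) * q ^ d / (q ^ n)\<^sup>2 - (q\<^sup>2 - 1) * (q * q ^ d + 1 / (q * q ^ d)))"
proof -
  define D z where "D = q ^ d" and "z = q ^ n"
  have nz: "D \<noteq> 0" "z \<noteq> 0" using q_nz by (auto simp: D_def z_def)
  define p where "p = coord d v n"
  have lin_p: "Vector_Spaces.linear scale (*) p" unfolding p_def by (rule linear_coord[OF basis_v])
  note p = functional_simps[OF lin_p]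
  have pv: "p (vv k) = (if k = int n then 1 else 0)" for k using assms by (simp add: p_def coord_vv)
  have pw: "q powi (2 * int n - int d) = z\<^sup>2 / D" "q powi (int d - 2 * int n) = D / z\<^sup>2"
    using q_nz by (simp_all add: powi_expand D_def z_def)
  have "p (x3 (x1 (vv n))) = (z\<^sup>2 / D)\<^sup>2 + low n * up (int n - 1)"
    unfolding x1_vv X3.add X3.scale x3_vv by (simp add: p pv pw power2_eq_square)
  then have 1: "(z\<^sup>2 / D)\<^sup>2 + low n * up (int n - 1)
      = 1 + t * (q * D + 1 / (q * D) - q * (D / z\<^sup>2) - 1 / q * p (x0 (vv n)))"
    unfolding prod31 x2_vv by (simp add: p pv pw D_def)
  have "p (x1 (x3 (vv n))) = (z\<^sup>2 / D)\<^sup>2 + low (int n + 1) * up n"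
    unfolding x3_vv X1.add X1.scale x1_vv by (simp add: p pv pw power2_eq_square)
  then have 2: "(z\<^sup>2 / D)\<^sup>2 + low (int n + 1) * up n
      = 1 + t * (q * D + 1 / (q * D) - q * p (x0 (vv n)) - 1 / q * (D / z\<^sup>2))"
    unfolding prod13 x2_vv by (simp add: p pv pw D_def)
  have g: "low (int n + 1) * up n = 1 + t * (q * D + 1 / (q * D) - q * p (x0 (vv n)) - 1 / q * (D / z\<^sup>2)) - (z\<^sup>2 / D)\<^sup>2"
    "low n * up (int n - 1) = 1 + t * (q * D + 1 / (q * D) - q * (D / z\<^sup>2) - 1 / q * p (x0 (vv n))) - (z\<^sup>2 / D)\<^sup>2"
    using 1 2 by (simp_all add: algebra_simps)
  show ?thesis
    unfolding D_def[symmetric] z_def[symmetric] g using q_nz nz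
    by (simp add: field_simps power2_eq_square power4_eq_xxxx)
qed

lemma up_minus_1: "up (- 1) = 0"
proof -
  have "scale (up (- 1)) (vv 0) = 0" using x3_vv[of "- 1"] by (simp add: padded_def X3.zero)
  from arg_cong[OF this, of "coord d v 0"] show ?thesis
    by (simp only: coord_scale[OF basis_v] coord_zero[OF basis_v] coord_vv) simp
qed

lemma low_up:
  assumes "n \<le> d"
  shows "low (int n) * up (int n - 1) =
    (q ^ d - (q ^ n)\<^sup>2 / (q\<^sup>2 * q ^ d)) * (1 / q ^ d - (q ^ n)\<^sup>2 / q ^ d) * (1 - t * q * q ^ d / (q ^ n)\<^sup>2)"
  using assms
proof (induction n)
  case 0
  then show ?case by (simp add: up_minus_1)
next
  case (Suc n)
  define D z where "D = q ^ d" and "z = q ^ n"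
  have nz: "D \<noteq> 0" "z \<noteq> 0" using q_nz by (auto simp: D_def z_def)
  have IH: "low (int n) * up (int n - 1) =
    (D - z\<^sup>2 / (q\<^sup>2 * D)) * (1 / D - z\<^sup>2 / D) * (1 - t * q * D / z\<^sup>2)"
    using Suc by (simp add: D_def z_def)
  have n: "n \<le> d" using Suc.prems by simp
  have "low (int n + 1) * up (int n) = (D - (q * z)\<^sup>2 / (q\<^sup>2 * D)) * (1 / D - (q * z)\<^sup>2 / D) * (1 - t * q * D / (q * z)\<^sup>2)"
    unfolding low_up_recursion[OF n] IH D_def[symmetric] z_def[symmetric] using q_nz nz
    by (simp add: field_simps power2_eq_square power4_eq_xxxx)
  then show ?case by (simp add: D_def z_def add.commute)
qed

text \<open>
  This is where the exclusion of the values \<open>q\<^bsup>d-2n+1\<^esup>\<close> for \<open>t\<close> enters: it keeps the last factor in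
  \<open>low_up\<close> from vanishing.
\<close>

lemma low_nonzero:
  assumes "1 \<le> n" "n \<le> d"
  shows "low (int n) \<noteq> 0"
proof
  assume "low (int n) = 0"
  moreover have "q ^ d - (q ^ n)\<^sup>2 / (q\<^sup>2 * q ^ d) \<noteq> 0"
  proof -
    have "q powi int d \<noteq> q powi (2 * int n - 2 - int d)" unfolding q_powi_inj using assms by simp
    then show ?thesis using q_nz by (simp add: powi_expand)
  qed
  moreover have "1 / q ^ d - (q ^ n)\<^sup>2 / q ^ d \<noteq> 0"
  proof -
    have "q powi (- int d) \<noteq> q powi (2 * int n - int d)" unfolding q_powi_inj using assms by simp
    then show ?thesis using q_nz by (simp add: powi_expand divide_inverse)
  qed
  moreover have "1 - t * q * q ^ d / (q ^ n)\<^sup>2 \<noteq> 0"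
  proof -
    have "t \<noteq> q powi (int d - 2 * int (d + 1 - n) + 1)"
      by (rule t_generic) (use assms in auto)
    also have "int d - 2 * int (d + 1 - n) + 1 = 2 * int n - 1 - int d" using assms by simp
    finally have "t \<noteq> (q ^ n)\<^sup>2 / (q * q ^ d)" using q_nz by (simp add: powi_expand)
    then show ?thesis using q_nz by (auto simp: field_simps)
  qed
  ultimately show False using low_up[OF assms(2)] by (metis mult_eq_0_iff mult_zero_left)
qed

section \<open>Rotation and the \<open>\<int>\<^sub>3\<close>-symmetric equations\<close>

lemma powi_inj_on: "inj_on (\<lambda>n. q powi (2 * int n - int d)) {..d}"
  by (simp add: inj_on_def q_powi_inj)

text \<open>
  The eigenvectors of \<open>x\<^sub>1\<close>, in the order in which \<open>x\<^sub>0\<close> is upper triangular. This basis serves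
  twice: it diagonalizes \<open>x\<^sub>0\<close>, and \<open>A\<close>, a combination of \<open>x\<^sub>0\<close> and \<open>x\<^sub>1\<close>, is triangular in it.
\<close>

lemma x1_triangular_basis:
  obtains r where "basis scale d r"
    "\<And>m. m \<le> d \<Longrightarrow> x1 (r m) = scale (q powi (int d - 2 * int m)) (r m)"
    "\<And>m. m \<le> d \<Longrightarrow> x0 (r m) - scale (q powi (2 * int m - int d)) (r m) \<in> span (r ` {..<m})"
proof -
  have tri: "x1 (v n) - scale (q powi (2 * int n - int d)) (v n) \<in> span (v ` {..<n})" if "n \<le> d" for n
  proof (cases n)
    case 0
    then show ?thesis using x1_vv[of 0] by (simp add: padded_def span_zero)
  next
    case (Suc m)
    have "vv (int n) = v n" using that by (simp add: padded_def)
    moreover have "vv (int n - 1) = v m" using that Suc by (simp add: padded_def)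
    ultimately have "x1 (v n) - scale (q powi (2 * int n - int d)) (v n) = scale (low (int n)) (v m)"
      using x1_vv[of "int n"] by simp
    then show ?thesis using Suc by (auto intro!: span_scale intro: span_base)
  qed
  obtain y where y: "basis scale d y"
    and x1_y: "\<And>n. n \<le> d \<Longrightarrow> x1 (y n) = scale (q powi (2 * int n - int d)) (y n)"
    using triangular_eigenbasis[OF basis_v linear(2) tri powi_inj_on] by blast
  let ?r = "\<lambda>m. y (d - m)"
  have r: "basis scale d ?r" by (rule basis_reverse[OF y])
  have x1_r: "x1 (?r m) = scale (q powi (int d - 2 * int m)) (?r m)" if "m \<le> d" for m
    using x1_y[of "d - m"] that by (simp add: of_nat_diff algebra_simps)
  have "x0 (?r m) - scale (q powi (2 * int m - int d)) (?r m) \<in> span (?r ` {..<m})" (is "?z \<in> _")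
    if m: "m \<le> d" for m
  proof -
    have inv: "1 / q powi (int d - 2 * int m) = q powi (2 * int m - int d)"
      using power_int_minus[of q "int d - 2 * int m"] by (simp add: divide_inverse)
    have "x1 ?z = scale (q\<^sup>2 * q powi (int d - 2 * int m)) ?z"
      using weyl_raise[OF weyl(1) linear(1,2) x1_r[OF m]] q_nz unfolding inv by simp
    also have "q\<^sup>2 * q powi (int d - 2 * int m) = q powi (int d - 2 * (int m - 1))"
      using q_nz power_int_add[of q 2 "int d - 2 * int m"] by (simp add: algebra_simps)
    finally have z: "x1 ?z = scale (q powi (int d - 2 * (int m - 1))) ?z" .
    show ?thesis
    proof (cases m)
      case 0
      have "?z = 0"
      proof (rule eq_if_coord_eq[OF r])
        fix i assume "i \<le> d"
        then show "coord d ?r i ?z = coord d ?r i 0"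
          unfolding coord_zero[OF r]
          by (intro eigenvector_coord[OF r linear(2) x1_r z]) (use 0 in \<open>auto simp: q_powi_inj\<close>)
      qed
      then show ?thesis by (simp add: span_zero)
    next
      case (Suc n)
      have "?z = scale (coord d ?r n ?z) (?r n)"
        by (rule eigenvector_multiple[OF r linear(2) x1_r z]) (use Suc m in \<open>auto simp: q_powi_inj\<close>)
      moreover have "scale (coord d ?r n ?z) (?r n) \<in> span (?r ` {..<m})"
        using Suc by (auto intro!: span_scale intro: span_base)
      ultimately show ?thesis by metis
    qed
  qed
  then show thesis using that[OF r x1_r] by blast
qed

text \<open>
  The relations are visibly invariant under the shift of the indices by 2; what remains is an eigenbasis
  of \<open>x\<^sub>0\<close> with the eigenvalues that \<open>x\<^sub>2\<close> has.
\<close>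

lemma rotated_module: "\<exists>v'. evaluation_module scale q t d x2 x3 x0 x1 v'"
proof -
  obtain r where r: "basis scale d r"
    "\<And>m. m \<le> d \<Longrightarrow> x0 (r m) - scale (q powi (2 * int m - int d)) (r m) \<in> span (r ` {..<m})"
    using x1_triangular_basis by blast
  obtain w where w: "basis scale d w"
    "\<And>n. n \<le> d \<Longrightarrow> x0 (w n) = scale (q powi (2 * int n - int d)) (w n)"
    using triangular_eigenbasis[OF r(1) linear(1) r(2) powi_inj_on] by blast
  have "evaluation_module scale q t d x2 x3 x0 x1 (\<lambda>n. w (d - n))"
  proof (intro evaluation_module.intro evaluation_module_axioms.intro)
    show "x0 (w (d - n)) = scale (q powi (int d - 2 * int n)) (w (d - n))" if "n \<le> d" for n
      using w(2)[of "d - n"] that by (simp add: of_nat_diff algebra_simps)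
  qed (rule coord_space_axioms q_nz t_nz linear weyl prod02 prod20 prod13 prod31 basis_reverse[OF w(1)]
      | erule q_not_root | erule (1) t_generic)+
  then show ?thesis by (intro exI[of _ "\<lambda>n. w (d - n)"])
qed

abbreviation op_A :: "'a \<Rightarrow> 'v \<Rightarrow> 'v" where
  "op_A a \<equiv> weighted_sum a x0 x1"

abbreviation op_B :: "'a \<Rightarrow> 'v \<Rightarrow> 'v" where
  "op_B b \<equiv> weighted_sum b x2 x3"

abbreviation op_C :: "'a \<Rightarrow> 'a \<Rightarrow> 'a \<Rightarrow> 'v \<Rightarrow> 'v" where
  "op_C a b c \<equiv> completion_op (a * q / b) c x3 x0"

lemma linear_ops: "Vector_Spaces.linear scale scale (op_A a)" "Vector_Spaces.linear scale scale (op_B b)"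
  "Vector_Spaces.linear scale scale (op_C a b c)"
  by (unfold_locales; simp add: weighted_sum_def completion_op_def lin_simps scale_right_distrib
      scale_right_diff_distrib mult_ac)+

lemma Z3_equationI:
  assumes "\<And>z. scale q (B (C z)) - scale (1 / q) (C (B z))
     = scale ((q - 1 / q) * askey_const q (q ^ d) a b c) z - scale (q\<^sup>2 - 1 / q\<^sup>2) (A z)"
  shows "Z3_equation q scale d a b c A B C"
  unfolding Z3_equation_def
proof (intro allI, rule eq_if_functionals_eq[OF basis_v])
  fix z p assume "Vector_Spaces.linear scale (*) p"
  note p = functional_simps[OF this]
  have h: "q * p (B (C z)) - 1 / q * p (C (B z))
     = (q - 1 / q) * askey_const q (q ^ d) a b c * p z - (q\<^sup>2 - 1 / q\<^sup>2) * p (A z)"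
    using arg_cong[OF assms[of z], of p] by (simp add: p)
  have N: "(a + inverse a) * (q ^ (d + 1) + inverse (q ^ (d + 1))) + (b + inverse b) * (c + inverse c)
      = askey_const q (q ^ d) a b c"
    by (simp add: askey_const_def divide_inverse)
  have s: "q + 1 / q \<noteq> 0"
  proof
    assume "q + 1 / q = 0"
    then have "q\<^sup>2 = - 1" using q_nz by (simp add: field_simps power2_eq_square eq_neg_iff_add_eq_0)
    then have "(q\<^sup>2)\<^sup>2 = 1" by simp
    then show False using q_facts(1) by (simp flip: power_mult)
  qed
  have w: "q\<^sup>2 - 1 / q\<^sup>2 = (q - 1 / q) * (q + 1 / q)"
    by (simp add: field_simps power2_eq_square)
  have "p (A z) + 1 / (q\<^sup>2 - 1 / q\<^sup>2) * (q * p (B (C z)) - 1 / q * p (C (B z)))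
      = askey_const q (q ^ d) a b c / (q + 1 / q) * p z"
    unfolding h using q_facts(3,4) s unfolding w by (simp add: diff_divide_distrib right_diff_distrib)
  then show "p (A z + scale (1 / (q\<^sup>2 - inverse (q\<^sup>2)))
        (scale q (B (C z)) - scale (inverse q) (C (B z))))
     = p (scale (((a + inverse a) * (q ^ (d + 1) + inverse (q ^ (d + 1)))
          + (b + inverse b) * (c + inverse c)) / (q + inverse q)) z)"
    unfolding N by (simp add: p divide_inverse)
qed

text \<open>
  After expansion the words of length three and the repeated squares cancel: the coefficients of
  \<open>x\<^sub>3 x\<^sub>3\<close> and \<open>x\<^sub>0 x\<^sub>0\<close> are multiples of \<open>c / b - a / t\<close> and \<open>a / c - t / b\<close>, which vanish for
  \<open>t = a b / c\<close>.
\<close>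

lemma Z3_equations:
  assumes nz: "a \<noteq> 0" "b \<noteq> 0" "c \<noteq> 0" and t: "t = a * b / c"
  shows "Z3_equation q scale d a b c (op_A a) (op_B b) (op_C a b c)"
    and "Z3_equation q scale d b c a (op_B b) (op_C a b c) (op_A a)"
    and "Z3_equation q scale d c a b (op_C a b c) (op_A a) (op_B b)"
proof -
  define L where "L = \<Lambda>"
  have askey: "askey_const q (q ^ d) a b c = (a + 1 / a) * L + (b + 1 / b) * (c + 1 / c)" for a b c
    by (simp add: askey_const_def L_def)
  have facts: "p (x1 (x0 z)) = q\<^sup>2 * p (x0 (x1 z)) - (q\<^sup>2 - 1) * p z"
    "p (x2 (x1 z)) = q\<^sup>2 * p (x1 (x2 z)) - (q\<^sup>2 - 1) * p z"
    "p (x3 (x2 z)) = q\<^sup>2 * p (x2 (x3 z)) - (q\<^sup>2 - 1) * p z"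
    "p (x0 (x3 z)) = q\<^sup>2 * p (x3 (x0 z)) - (q\<^sup>2 - 1) * p z"
    "p (x0 (x2 z)) = p z + 1 / t * (L * p z - q * p (x3 z) - 1 / q * p (x1 z))"
    "p (x2 (x0 z)) = p z + 1 / t * (L * p z - q * p (x1 z) - 1 / q * p (x3 z))"
    "p (x1 (x3 z)) = p z + t * (L * p z - q * p (x0 z) - 1 / q * p (x2 z))"
    "p (x3 (x1 z)) = p z + t * (L * p z - q * p (x2 z) - 1 / q * p (x0 z))"
    "p (x3 (x0 (x1 z))) = (1 / q * p (x1 (x3 (x0 z))) + (q - 1 / q) * (p (x3 z) + t / q * p (x0 (x0 z))
       - t / q * p z - 1 / q * (L * p z - q * p (x1 z) - 1 / q * p (x3 z)))) / q"
    "p (x2 (x3 (x0 z))) = (1 / q * p (x3 (x0 (x2 z))) + (q - 1 / q) * (p (x0 z) + 1 / (q * t) * p (x3 (x3 z))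
       - 1 / (q * t) * p z - 1 / q * (L * p z - q * p (x2 z) - 1 / q * p (x0 z)))) / q"
    "p (x0 (x3 (x0 z))) = q\<^sup>2 * p (x3 (x0 (x0 z))) - (q\<^sup>2 - 1) * p (x0 z)"
    "p (x3 (x0 (x3 z))) = q\<^sup>2 * p (x3 (x3 (x0 z))) - (q\<^sup>2 - 1) * p (x3 z)"
    if "Vector_Spaces.linear scale (*) p" for p z
  proof -
    note p = functional_simps[OF that]
    show "p (x1 (x0 z)) = q\<^sup>2 * p (x0 (x1 z)) - (q\<^sup>2 - 1) * p z"
      "p (x2 (x1 z)) = q\<^sup>2 * p (x1 (x2 z)) - (q\<^sup>2 - 1) * p z"
      "p (x3 (x2 z)) = q\<^sup>2 * p (x2 (x3 z)) - (q\<^sup>2 - 1) * p z"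
      "p (x0 (x3 z)) = q\<^sup>2 * p (x3 (x0 z)) - (q\<^sup>2 - 1) * p z"
      "p (x0 (x3 (x0 z))) = q\<^sup>2 * p (x3 (x0 (x0 z))) - (q\<^sup>2 - 1) * p (x0 z)"
      unfolding weyl_swap by (simp_all add: p)
    show "p (x3 (x0 (x3 z))) = q\<^sup>2 * p (x3 (x3 (x0 z))) - (q\<^sup>2 - 1) * p (x3 z)"
      unfolding weyl_swap(4) by (simp add: lin_simps p)
    show "p (x0 (x2 z)) = p z + 1 / t * (L * p z - q * p (x3 z) - 1 / q * p (x1 z))"
      "p (x2 (x0 z)) = p z + 1 / t * (L * p z - q * p (x1 z) - 1 / q * p (x3 z))"
      "p (x1 (x3 z)) = p z + t * (L * p z - q * p (x0 z) - 1 / q * p (x2 z))"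
      "p (x3 (x1 z)) = p z + t * (L * p z - q * p (x2 z) - 1 / q * p (x0 z))"
      unfolding prod02 prod20 prod13 prod31 by (simp_all add: p L_def)
    have "q * p (x3 (x0 (x1 z))) - 1 / q * p (x1 (x3 (x0 z))) = (q - 1 / q) * (p (x3 z) + t / q * p (x0 (x0 z))
       - t / q * p z - 1 / q * (L * p z - q * p (x1 z) - 1 / q * p (x3 z)))"
      using arg_cong[OF triple_products(1)[of z], of p] unfolding p L_def by simp
    then show "p (x3 (x0 (x1 z))) = (1 / q * p (x1 (x3 (x0 z))) + (q - 1 / q) * (p (x3 z) + t / q * p (x0 (x0 z))
       - t / q * p z - 1 / q * (L * p z - q * p (x1 z) - 1 / q * p (x3 z)))) / q"
      using q_nz by (simp add: eq_divide_eq mult.commute diff_eq_eq add.commute)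
    have "q * p (x2 (x3 (x0 z))) - 1 / q * p (x3 (x0 (x2 z))) = (q - 1 / q) * (p (x0 z) + 1 / (q * t) * p (x3 (x3 z))
       - 1 / (q * t) * p z - 1 / q * (L * p z - q * p (x2 z) - 1 / q * p (x0 z)))"
      using arg_cong[OF triple_products(2)[of z], of p] unfolding p L_def by simp
    then show "p (x2 (x3 (x0 z))) = (1 / q * p (x3 (x0 (x2 z))) + (q - 1 / q) * (p (x0 z) + 1 / (q * t) * p (x3 (x3 z))
       - 1 / (q * t) * p z - 1 / q * (L * p z - q * p (x2 z) - 1 / q * p (x0 z)))) / q"
      using q_nz by (simp add: eq_divide_eq mult.commute diff_eq_eq add.commute)
  qed
  show "Z3_equation q scale d a b c (op_A a) (op_B b) (op_C a b c)"
  proof (rule Z3_equationI, rule eq_if_functionals_eq[OF basis_v])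
    fix z p assume lin_p: "Vector_Spaces.linear scale (*) p"
    note p = functional_simps[OF lin_p]
    show "p (scale q (op_B b (op_C a b c z)) - scale (1 / q) (op_C a b c (op_B b z)))
       = p (scale ((q - 1 / q) * askey_const q (q ^ d) a b c) z - scale (q\<^sup>2 - 1 / q\<^sup>2) (op_A a z))"
      unfolding weighted_sum_def completion_op_def lin_simps p facts[OF lin_p] askey t
      using q_nz nz by (simp add: field_simps power2_eq_square)
  qed
  show "Z3_equation q scale d b c a (op_B b) (op_C a b c) (op_A a)"
  proof (rule Z3_equationI, rule eq_if_functionals_eq[OF basis_v])
    fix z p assume lin_p: "Vector_Spaces.linear scale (*) p"
    note p = functional_simps[OF lin_p]
    show "p (scale q (op_C a b c (op_A a z)) - scale (1 / q) (op_A a (op_C a b c z)))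
       = p (scale ((q - 1 / q) * askey_const q (q ^ d) b c a) z - scale (q\<^sup>2 - 1 / q\<^sup>2) (op_B b z))"
      unfolding weighted_sum_def completion_op_def lin_simps p facts[OF lin_p] askey t
      using q_nz nz by (simp add: field_simps power2_eq_square)
  qed
  show "Z3_equation q scale d c a b (op_C a b c) (op_A a) (op_B b)"
  proof (rule Z3_equationI, rule eq_if_functionals_eq[OF basis_v])
    fix z p assume lin_p: "Vector_Spaces.linear scale (*) p"
    note p = functional_simps[OF lin_p]
    show "p (scale q (op_A a (op_B b z)) - scale (1 / q) (op_B b (op_A a z)))
       = p (scale ((q - 1 / q) * askey_const q (q ^ d) c a b) z - scale (q\<^sup>2 - 1 / q\<^sup>2) (op_C a b c z))"
      unfolding weighted_sum_def completion_op_def lin_simps p facts[OF lin_p] askey t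
      using q_nz nz by (simp add: field_simps power2_eq_square)
  qed
qed

section \<open>Split bases of an evaluation module\<close>

lemma op_A_eigenbasis:
  assumes inj: "inj_on (theta q d a) {..d}"
  obtains w where "basis scale d w" "\<And>n. n \<le> d \<Longrightarrow> op_A a (w n) = scale (theta q d a n) (w n)"
proof -
  obtain r where r: "basis scale d r"
    "\<And>m. m \<le> d \<Longrightarrow> x1 (r m) = scale (q powi (int d - 2 * int m)) (r m)"
    "\<And>m. m \<le> d \<Longrightarrow> x0 (r m) - scale (q powi (2 * int m - int d)) (r m) \<in> span (r ` {..<m})"
    using x1_triangular_basis by blast
  have "op_A a (r m) - scale (theta q d a m) (r m) \<in> span (r ` {..<m})" if "m \<le> d" for m
  proof -
    have "op_A a (r m) - scale (theta q d a m) (r m)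
        = scale a (x0 (r m) - scale (q powi (2 * int m - int d)) (r m))"
      unfolding weighted_sum_def theta_def r(2)[OF that]
      by (simp add: scale_right_diff_distrib scale_left_distrib divide_inverse)
    then show ?thesis using span_scale[OF r(3)[OF that]] by simp
  qed
  from triangular_eigenbasis[OF r(1) linear_ops(1) this inj] that show thesis by blast
qed

text \<open>
  In an eigenbasis of \<open>A\<close> the product of all \<open>A - g m\<close> vanishes once every eigenvalue occurs among the \<open>g m\<close>.
\<close>

lemma op_A_sequence_vanishes:
  assumes inj: "inj_on (theta q d a) {..d}"
    and u: "\<And>n. u (Suc n) = op_A a (u n) - scale (g n) (u n)"
    and g: "\<And>i. i \<le> d \<Longrightarrow> \<exists>m\<le>d. g m = theta q d a i"
  shows "u (Suc d) = 0"
proof -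
  obtain w where w: "basis scale d w" "\<And>n. n \<le> d \<Longrightarrow> op_A a (w n) = scale (theta q d a n) (w n)"
    using op_A_eigenbasis[OF inj] by blast
  have "coord d w i (u n) = (\<Prod>m<n. theta q d a i - g m) * coord d w i (u 0)" if "i \<le> d" for i n
    by (induction n) (simp_all add: u coord_diff[OF w(1)] coord_scale[OF w(1)]
        coord_eigenbasis[OF w(1) linear_ops(1) w(2) that] algebra_simps)
  note components = this
  have "(\<Prod>m<Suc d. theta q d a i - g m) = 0" if i: "i \<le> d" for i
  proof -
    obtain m where m: "m \<le> d" "g m = theta q d a i" using g[OF i] by blast
    have "\<exists>m\<in>{..<Suc d}. theta q d a i - g m = 0"
    proof (rule bexI)
      show "theta q d a i - g m = 0" unfolding m(2) by (rule diff_self)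
      show "m \<in> {..<Suc d}" using m(1) by simp
    qed
    then show ?thesis by (rule prod_zero[OF finite_lessThan])
  qed
  with components[of _ "Suc d"] have "coord d w i (u (Suc d)) = coord d w i 0" if "i \<le> d" for i
    using that by (simp only: coord_zero[OF w(1)] mult_zero_left)
  then show ?thesis by (rule eq_if_coord_eq[OF w(1)])
qed

text \<open>
  The Casimir relation for \<open>x\<^sub>1 x\<^sub>3\<close> is linear in \<open>x\<^sub>0\<close> and hence determines it as a tridiagonal operator.
\<close>

lemma x0_vv: "x0 (vv k) = scale ((\<Lambda> + 1 / t - q powi (int d - 2 * k) / q
      - ((q powi (2 * k - int d))\<^sup>2 + up k * low (k + 1)) / t) / q) (vv k)
    + scale (- up k * q powi (2 * (k + 1) - int d) / (q * t)) (vv (k + 1))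
    + scale (- low k * q powi (2 * k - int d) / (q * t)) (vv (k - 1))"
proof (rule eq_if_functionals_eq[OF basis_v])
  fix p assume lin_p: "Vector_Spaces.linear scale (*) p"
  note p = functional_simps[OF lin_p]
  define L where "L = \<Lambda>"
  define y where "y = q powi (2 * k - int d)"
  define y' where "y' = q powi (2 * (k + 1) - int d)"
  define e where "e = q powi (int d - 2 * k)"
  have "x1 (x3 (vv k)) = scale y (scale y (vv k) + scale (low k) (vv (k - 1)))
      + scale (up k) (scale y' (vv (k + 1)) + scale (low (k + 1)) (vv k))"
    unfolding x3_vv X1.add X1.scale x1_vv by (simp add: y_def y'_def)
  then have "y * (y * p (vv k) + low k * p (vv (k - 1))) + up k * (y' * p (vv (k + 1)) + low (k + 1) * p (vv k))
     = p (vv k) + t * (L * p (vv k) - q * p (x0 (vv k)) - 1 / q * (e * p (vv k)))"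
    using arg_cong[OF prod13[of "vv k"], of p] unfolding x2_vv L_def e_def by (simp add: p)
  then have "t * q * p (x0 (vv k)) = p (vv k) + t * (L * p (vv k) - 1 / q * (e * p (vv k)))
      - (y * (y * p (vv k) + low k * p (vv (k - 1))) + up k * (y' * p (vv (k + 1)) + low (k + 1) * p (vv k)))"
    by (simp add: algebra_simps)
  then have x0: "p (x0 (vv k)) = (p (vv k) + t * (L * p (vv k) - 1 / q * (e * p (vv k)))
      - (y * (y * p (vv k) + low k * p (vv (k - 1))) + up k * (y' * p (vv (k + 1)) + low (k + 1) * p (vv k)))) / (t * q)"
    using t_nz q_nz by (simp add: eq_divide_eq mult_ac)
  show "p (x0 (vv k)) = p (scale ((\<Lambda> + 1 / t - q powi (int d - 2 * k) / q
      - ((q powi (2 * k - int d))\<^sup>2 + up k * low (k + 1)) / t) / q) (vv k)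
    + scale (- up k * q powi (2 * (k + 1) - int d) / (q * t)) (vv (k + 1))
    + scale (- low k * q powi (2 * k - int d) / (q * t)) (vv (k - 1)))"
    unfolding L_def[symmetric] y_def[symmetric] y'_def[symmetric] e_def[symmetric] p x0
    using t_nz q_nz by (simp add: divide_simps) (simp add: algebra_simps power2_eq_square)
qed

lemma op_A_vv:
  "\<exists>c1 c2. op_A a (vv k) = scale c1 (vv k) + scale c2 (vv (k + 1))
     + scale (low k * (1 / a - a / t * q powi (2 * k - int d - 1))) (vv (k - 1))"
proof -
  define y where "y = q powi (2 * k - int d)"
  have y: "q powi (2 * k - int d - 1) = y / q"
    using q_nz by (simp add: power_int_diff y_def)
  obtain c1 c2 where x0: "x0 (vv k) = scale c1 (vv k) + scale c2 (vv (k + 1))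
    + scale (- low k * y / (q * t)) (vv (k - 1))"
    using x0_vv[of k] unfolding y_def by blast
  have x1: "x1 (vv k) = scale y (vv k) + scale (low k) (vv (k - 1))"
    using x1_vv[of k] unfolding y_def .
  have "op_A a (vv k) = scale (a * c1 + y / a) (vv k) + scale (a * c2) (vv (k + 1))
     + scale (low k * (1 / a - a / t * (y / q))) (vv (k - 1))"
  proof (rule eq_if_functionals_eq[OF basis_v])
    fix p assume "Vector_Spaces.linear scale (*) p"
    note p = functional_simps[OF this]
    show "p (op_A a (vv k)) = p (scale (a * c1 + y / a) (vv k) + scale (a * c2) (vv (k + 1))
       + scale (low k * (1 / a - a / t * (y / q))) (vv (k - 1)))"
      unfolding weighted_sum_def x0 x1 p by (simp add: divide_inverse algebra_simps)
  qed
  then show ?thesis unfolding y by blast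
qed

text \<open>
  In the reversed eigenbasis of \<open>x\<^sub>2\<close> the operator \<open>A\<close> moves every vector one step further along the flag,
  so \<open>u n\<close> has a nonzero leading coefficient. The coefficient of a step is
  \<open>low k / a\<close> times \<open>1 - (a c / b) q\<^bsup>2k-d-1\<^esup>\<close>.
\<close>

lemma split_basis_independent:
  assumes nz: "a \<noteq> 0" "b \<noteq> 0" "c \<noteq> 0" and t: "t = a * b / c"
    and ne: "\<And>k. 1 \<le> k \<Longrightarrow> k \<le> d \<Longrightarrow> a * c / b \<noteq> q powi (int d - 2 * int k + 1)"
    and u0: "u 0 = v d"
    and u: "\<And>n. u (Suc n) = op_A a (u n) - scale (g n) (u n)"
  shows "basis scale d u"
proof -
  interpret A: Vector_Spaces.linear scale scale "op_A a" by (rule linear_ops)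
  let ?r = "\<lambda>n. v (d - n)"
  have r: "basis scale d ?r" by (rule basis_reverse[OF basis_v])
  have Ar: "\<exists>h\<noteq>0. op_A a (?r m) - scale h (?r (Suc m)) \<in> span (?r ` {..<Suc m})" if m: "m < d" for m
  proof -
    define k where "k = int d - int m"
    define h where "h = low k * (1 / a - a / t * q powi (2 * k - int d - 1))"
    obtain c1 c2 where Avv: "op_A a (vv k) = scale c1 (vv k) + scale c2 (vv (k + 1)) + scale h (vv (k - 1))"
      using op_A_vv unfolding h_def by blast
    have vv: "vv k = ?r m" "vv (k - 1) = ?r (Suc m)"
      using m by (auto simp: k_def padded_def nat_diff_distrib of_nat_diff intro!: arg_cong[of _ _ v])
    have "scale c2 (vv (k + 1)) \<in> span (?r ` {..<Suc m})"
    proof (cases m)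
      case 0
      then show ?thesis by (simp add: padded_def k_def span_zero)
    next
      case (Suc j)
      then have "vv (k + 1) = ?r j"
        using m by (auto simp: k_def padded_def intro!: arg_cong[of _ _ v])
      then show ?thesis using Suc by (auto intro!: span_scale intro: span_base)
    qed
    moreover have "scale c1 (?r m) \<in> span (?r ` {..<Suc m})" by (auto intro!: span_scale intro: span_base)
    moreover have "op_A a (?r m) - scale h (?r (Suc m)) = scale c1 (?r m) + scale c2 (vv (k + 1))"
      using Avv unfolding vv by simp
    ultimately have "op_A a (?r m) - scale h (?r (Suc m)) \<in> span (?r ` {..<Suc m})"
      by (simp only: span_add)
    moreover have "h \<noteq> 0"
    proof
      assume "h = 0"
      moreover have "low k \<noteq> 0" using low_nonzero[of "d - m"] m by (simp add: k_def of_nat_diff)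
      ultimately have "1 / a = a / t * q powi (2 * k - int d - 1)" by (simp add: h_def)
      then have "a * c / b * q powi (2 * k - int d - 1) = 1" using nz by (simp add: t field_simps)
      moreover have "q powi (2 * k - int d - 1) \<noteq> 0" using q_nz by simp
      ultimately have "a * c / b = 1 / q powi (2 * k - int d - 1)" 
        using nonzero_eq_divide_eq[of "q powi (2 * k - int d - 1)" "a * c / b" 1] by blast
      also have "\<dots> = q powi (- (2 * k - int d - 1))"
        by (simp only: power_int_minus divide_inverse mult_1)
      also have "- (2 * k - int d - 1) = int d - 2 * int (d - m) + 1"
        using m by (simp add: k_def of_nat_diff)
      finally have eq: "a * c / b = q powi (int d - 2 * int (d - m) + 1)" .
      have "1 \<le> d - m" "d - m \<le> d" using m by auto
      from ne[OF this] eq show False by (rule notE)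
    qed
    ultimately show ?thesis by (intro exI[of _ h] conjI)
  qed
  have Aspan: "op_A a z \<in> span (?r ` {..<Suc n})" if "z \<in> span (?r ` {..<n})" "n \<le> d" for z n
    using that(1)
  proof (induction rule: span_induct_alt)
    case base
    then show ?case by (simp add: A.zero span_zero)
  next
    case (step c x y)
    then obtain m where m: "m < n" "x = ?r m" by auto
    then obtain h where h: "op_A a x - scale h (?r (Suc m)) \<in> span (?r ` {..<Suc m})"
      using Ar[of m] \<open>n \<le> d\<close> by auto
    have "span (?r ` {..<Suc m}) \<subseteq> span (?r ` {..<Suc n})"
      using m by (intro span_mono image_mono) auto
    moreover have "scale h (?r (Suc m)) \<in> span (?r ` {..<Suc n})"
      using m by (auto intro!: span_scale intro: span_base)
    ultimately have "(op_A a x - scale h (?r (Suc m))) + scale h (?r (Suc m)) \<in> span (?r ` {..<Suc n})"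
      by (intro span_add[OF subsetD[OF _ h]])
    then have "op_A a x \<in> span (?r ` {..<Suc n})" by simp
    with step show ?case by (simp add: A.add A.scale span_add span_scale)
  qed
  have "\<exists>k\<noteq>0. u n - scale k (?r n) \<in> span (?r ` {..<n})" if "n \<le> d" for n
    using that
  proof (induction n)
    case 0
    then show ?case by (intro exI[of _ 1]) (simp add: u0 span_zero)
  next
    case (Suc n)
    then obtain k where k: "k \<noteq> 0" "u n - scale k (?r n) \<in> span (?r ` {..<n})" by auto
    obtain h where h: "h \<noteq> 0" "op_A a (?r n) - scale h (?r (Suc n)) \<in> span (?r ` {..<Suc n})"
      using Ar[of n] Suc.prems by auto
    have 1: "op_A a (u n - scale k (?r n)) \<in> span (?r ` {..<Suc n})"
      using Aspan[OF k(2)] Suc.prems by simp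
    have 2: "scale k (op_A a (?r n) - scale h (?r (Suc n))) \<in> span (?r ` {..<Suc n})"
      by (rule span_scale[OF h(2)])
    have mono: "span (?r ` {..<n}) \<subseteq> span (?r ` {..<Suc n})"
      by (intro span_mono image_mono) auto
    have rn: "scale k (?r n) \<in> span (?r ` {..<Suc n})"
      by (auto intro!: span_scale intro: span_base)
    have "(u n - scale k (?r n)) + scale k (?r n) \<in> span (?r ` {..<Suc n})"
      by (rule span_add[OF subsetD[OF mono k(2)] rn])
    then have 3: "scale (g n) (u n) \<in> span (?r ` {..<Suc n})"
      by (intro span_scale) simp
    have "u (Suc n) - scale (k * h) (?r (Suc n))
      = op_A a (u n - scale k (?r n)) + scale k (op_A a (?r n) - scale h (?r (Suc n))) - scale (g n) (u n)"
      by (simp add: u A.diff A.scale scale_right_diff_distrib)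
    also have "\<dots> \<in> span (?r ` {..<Suc n})" by (rule span_diff[OF span_add[OF 1 2] 3])
    finally show ?case using k(1) h(1) by (intro exI[of _ "k * h"]) simp
  qed
  then have "\<forall>n\<in>{..d}. \<exists>k. k \<noteq> 0 \<and> u n - scale k (?r n) \<in> span (?r ` {..<n})" by auto
  from bchoice[OF this] obtain k
    where k: "\<forall>n\<in>{..d}. k n \<noteq> 0 \<and> u n - scale (k n) (?r n) \<in> span (?r ` {..<n})" ..
  show ?thesis by (rule triangular_basis[OF r, where k = k]) (use k in auto)
qed

lemma Z3_equation_inverse:
  "Z3_equation q scale d (inverse a) b c A B C = Z3_equation q scale d a b c A B C"
  "Z3_equation q scale d b (inverse a) c A B C = Z3_equation q scale d b a c A B C"
  "Z3_equation q scale d b c (inverse a) A B C = Z3_equation q scale d b c a A B C"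
  by (simp_all add: Z3_equation_def add.commute)

lemma op_B_v_d: "op_B b (v d) = scale (theta q d b 0) (v d)"
proof -
  have [simp]: "vv (int d) = v d" "vv (int d + 1) = 0" by (auto simp: padded_def)
  show ?thesis
    using x2_vv[of "int d"] x3_vv[of "int d"] q_nz
    by (simp add: weighted_sum_def theta_def divide_inverse flip: scale_left_distrib)
qed

text \<open>
  The initial condition of \<open>split_recursion\<close>. Its right-hand side is invariant under exchanging \<open>a\<close> and its
  inverse, so the same starting vector serves both split forms.
\<close>

lemma op_C_v_d:
  assumes nz: "a \<noteq> 0" "b \<noteq> 0" "c \<noteq> 0" and t: "t = a * b / c"
  shows "op_C a b c (v d) + scale (q ^ d / (q * b)) (op_A a (v d))
       = scale ((c + 1 / c) * q ^ d + (a + 1 / a) / (q * b)) (v d)"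
proof (rule eq_if_functionals_eq[OF basis_v])
  fix p assume "Vector_Spaces.linear scale (*) p"
  note p = functional_simps[OF this]
  define D where "D = q ^ d"
  have D: "D \<noteq> 0" using q_nz by (simp add: D_def)
  have [simp]: "vv (int d) = v d" "vv (int d + 1) = 0" by (auto simp: padded_def)
  have x3: "x3 (v d) = scale D (v d)"
    using x3_vv[of "int d"] by (simp add: D_def)
  have x2: "x2 (v d) = scale (1 / D) (v d)"
    using x2_vv[of "int d"] by (simp add: D_def power_int_minus divide_inverse)
  have 1: "p (x0 (v d)) = (q * D + 1 / (q * D) - 1 / q * (1 / D)) / q * p (v d)
      - (D * p (x1 (v d)) - p (v d)) / (t * q)"
    using arg_cong[OF prod13[of "v d"], of p] t_nz q_nz unfolding x3 x2
    by (simp add: p X1.scale D_def[symmetric]) (simp add: field_simps)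
  have 2: "p (x3 (x0 (v d))) = (D * p (x0 (v d)) + (q\<^sup>2 - 1) * p (v d)) / q\<^sup>2"
    using arg_cong[OF weyl_swap(4)[of "v d"], of p] q_nz unfolding x3
    by (simp add: p X0.scale)
  show "p (op_C a b c (v d) + scale (q ^ d / (q * b)) (op_A a (v d)))
       = p (scale ((c + 1 / c) * q ^ d + (a + 1 / a) / (q * b)) (v d))"
    unfolding weighted_sum_def completion_op_def p x3 2 unfolding 1 t D_def[symmetric]
    using nz q_nz D by (simp add: field_simps power2_eq_square)
qed

text \<open>
  The case \<open>s = inverse a\<close> reverses the order of the eigenvalues of \<open>A\<close>.
\<close>

lemma split_form_op:
  assumes nz: "a \<noteq> 0" "b \<noteq> 0" "c \<noteq> 0" and t: "t = a * b / c"
    and inj: "inj_on (theta q d a) {..d}"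
    and ne: "\<And>k. 1 \<le> k \<Longrightarrow> k \<le> d \<Longrightarrow> a * c / b \<noteq> q powi (int d - 2 * int k + 1)"
    and s: "s = a \<or> s = inverse a"
  shows "split_form d (op_A a) (op_B b) (theta q d s) (theta q d b) (varphi q s b c d)"
proof -
  define u where "u = rec_nat (v d) (\<lambda>n z. op_A a z - scale (theta q d s n) z)"
  have u0: "u 0 = v d" and u: "\<And>n. u (Suc n) = op_A a (u n) - scale (theta q d s n) (u n)"
    by (simp_all add: u_def)
  have s_nz: "s \<noteq> 0" and sa: "s + 1 / s = a + 1 / a" using s nz by (auto simp: divide_inverse)
  have flip: "theta q d (inverse a) n = theta q d a (d - n)" if "n \<le> d" for n
    using that by (simp add: theta_def of_nat_diff algebra_simps)
  have end_u: "u (Suc d) = 0"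
  proof (rule op_A_sequence_vanishes[where g = "theta q d s" and a = a and u = u, OF inj u])
    show "\<exists>m\<le>d. theta q d s m = theta q d a i" if "i \<le> d" for i
      using s that flip[of "d - i"] by (cases "s = a") (auto intro: exI[of _ "d - i"])
  qed
  have Z: "Z3_equation q scale d b c s (op_B b) (op_C a b c) (op_A a)"
    "Z3_equation q scale d c s b (op_C a b c) (op_A a) (op_B b)"
    using Z3_equations(2,3)[OF nz t] s by (auto simp: Z3_equation_inverse)
  have rec: "op_B b (u n) = scale (theta q d b n) (u n) + scale (varphi q s b c d n) (u (n - 1))" for n
    by (rule conjunct1[OF split_recursion[OF basis_v q_nz q_facts(1) s_nz nz(2,3) linear_ops Z _ _ u]])
      (use op_B_v_d[of b] op_C_v_d[OF nz t] in \<open>simp_all add: u0 sa\<close>)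
  have "varphi q s b c d 0 = 0" by (simp add: varphi_def)
  then have "represents scale d u (upper_bidiag d (theta q d b) (varphi q s b c d)) (op_B b)"
    unfolding represents_upper_bidiag_iff using linear_ops rec by auto
  moreover have "represents scale d u (lower_bidiag d (theta q d s)) (op_A a)"
    unfolding represents_lower_bidiag_iff
  proof (intro conjI allI impI)
    show "op_A a (u n) = scale (theta q d s n) (u n) + (if n < d then u (Suc n) else 0)" if "n \<le> d" for n
      using u[of n] end_u that by (cases "n = d") auto
  qed (rule linear_ops)
  moreover have "basis scale d u"
    by (rule split_basis_independent[OF nz t ne u0 u])
  ultimately show ?thesis unfolding split_form_def by blast
qed

section \<open>Feasible parameters and the Leonard property\<close>

lemma feasible_parameters:
  assumes nz: "a \<noteq> 0" "b \<noteq> 0" "c \<noteq> 0" and feas: "feasible q a b c d"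
  shows feasible_inj: "inj_on (theta q d a) {..d}"
    and feasible_split: "\<And>k. 1 \<le> k \<Longrightarrow> k \<le> d \<Longrightarrow> a * c / b \<noteq> q powi (int d - 2 * int k + 1)"
    and feasible_varphi: "\<And>n. 1 \<le> n \<Longrightarrow> n \<le> d \<Longrightarrow> varphi q a b c d n \<noteq> 0"
    and feasible_phi: "\<And>n. 1 \<le> n \<Longrightarrow> n \<le> d \<Longrightarrow> phi q a b c d n \<noteq> 0"
proof -
  have sq: "a\<^sup>2 \<noteq> q powi (2 * k)" if "1 - int d \<le> k" "k \<le> int d - 1" for k
    using feas that unfolding feasible_def by blast
  have prods: "a * b * c \<noteq> q powi (int d - 2 * int n + 1)" "inverse a * b * c \<noteq> q powi (int d - 2 * int n + 1)"
    "a * inverse b * c \<noteq> q powi (int d - 2 * int n + 1)" "a * b * inverse c \<noteq> q powi (int d - 2 * int n + 1)"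
    if "1 \<le> n" "n \<le> d" for n
    using feas that unfolding feasible_def by blast+
  show "inj_on (theta q d a) {..d}"
    by (rule feasible_theta_inj[OF q_nz nz(1) sq q_powi_inj])
  show "a * c / b \<noteq> q powi (int d - 2 * int k + 1)" if "1 \<le> k" "k \<le> d" for k
    using prods(3)[OF that] by (simp add: divide_inverse mult_ac)
  have factor: "q powi (- int n) - x * q powi (int n - int d - 1) \<noteq> 0"
    if "x \<noteq> q powi (int d - 2 * int n + 1)" for x n
  proof
    assume "q powi (- int n) - x * q powi (int n - int d - 1) = 0"
    then have "q powi (- int n) = x * q powi (int n - int d - 1)" by simp
    then have "x = q powi (- int n) / q powi (int n - int d - 1)" using q_nz by simp
    also have "\<dots> = q powi (- int n - (int n - int d - 1))" 
      using q_nz by (subst power_int_diff) simp_all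
    also have "- int n - (int n - int d - 1) = int d - 2 * int n + 1" by simp
    finally show False using that by simp
  qed
  have common: "q powi int n - q powi (- int n) \<noteq> 0" "q powi (int n - int d - 1) - q powi (int d - int n + 1) \<noteq> 0"
    if "1 \<le> n" "n \<le> d" for n
    using q_powi_inj[of "int n" "- int n"] q_powi_inj[of "int n - int d - 1" "int d - int n + 1"] that by auto
  show "varphi q a b c d n \<noteq> 0" if "1 \<le> n" "n \<le> d" for n
    unfolding varphi_def
    using factor[OF prods(1)[OF that]] factor[OF prods(4)[OF that]] common[OF that] nz q_nz
    by (simp del: right_minus_eq power_int_of_nat)
  have last: "inverse a * b * inverse c \<noteq> q powi (int d - 2 * int n + 1)" if "1 \<le> n" "n \<le> d" for n
  proof
    assume "inverse a * b * inverse c = q powi (int d - 2 * int n + 1)"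
    then have "inverse (inverse a * b * inverse c) = inverse (q powi (int d - 2 * int n + 1))" by simp
    then have "a * inverse b * c = q powi (- (int d - 2 * int n + 1))"
      by (simp only: power_int_minus) (simp add: mult_ac)
    also have "- (int d - 2 * int n + 1) = int d - 2 * int (d + 1 - n) + 1"
      using that by (simp add: of_nat_diff)
    finally have eq: "a * inverse b * c = q powi (int d - 2 * int (d + 1 - n) + 1)" .
    have "1 \<le> d + 1 - n" "d + 1 - n \<le> d" using that by auto
    from prods(3)[OF this] eq show False by (rule notE)
  qed
  show "phi q a b c d n \<noteq> 0" if "1 \<le> n" "n \<le> d" for n
    unfolding phi_def
    using factor[OF prods(2)[OF that]] factor[OF last[OF that]] common[OF that] nz q_nz
    by (simp del: right_minus_eq power_int_of_nat)
qed

lemma split_forms: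
  assumes nz: "a \<noteq> 0" "b \<noteq> 0" "c \<noteq> 0" and t: "t = a * b / c" and feas: "feasible q a b c d"
  shows "split_form d (op_A a) (op_B b) (theta q d a) (theta q d b) (varphi q a b c d)"
    and "split_form d (op_A a) (op_B b) (\<lambda>n. theta q d a (d - n)) (theta q d b) (phi q a b c d)"
proof -
  note split = split_form_op[OF nz t feasible_inj[OF nz feas] feasible_split[OF nz feas]]
  show "split_form d (op_A a) (op_B b) (theta q d a) (theta q d b) (varphi q a b c d)"
    by (rule split) simp_all
  have "split_form d (op_A a) (op_B b) (theta q d (inverse a)) (theta q d b) (varphi q (inverse a) b c d)"
    by (rule split) simp_all
  moreover have "varphi q (inverse a) b c d = phi q a b c d"
    by (rule ext) (simp add: varphi_def phi_def)
  moreover have "lower_bidiag d (theta q d (inverse a)) = lower_bidiag d (\<lambda>n. theta q d a (d - n))"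
    by (rule eq_matI) (auto simp: lower_bidiag_def theta_def of_nat_diff algebra_simps)
  ultimately show "split_form d (op_A a) (op_B b) (\<lambda>n. theta q d a (d - n)) (theta q d b) (phi q a b c d)"
    by (simp add: split_form_def)
qed

lemma half_leonard:
  assumes nz: "a \<noteq> 0" "b \<noteq> 0" "c \<noteq> 0" and t: "t = a * b / c" and feas: "feasible q a b c d"
  shows "\<exists>w M N. basis scale d w \<and> represents scale d w M (op_A a) \<and> represents scale d w N (op_B b) \<and>
          diagonal_mat M \<and> irred_tridiagonal N"
  by (rule half_leonard_pair[OF split_forms[OF nz t feas] feasible_inj[OF nz feas]
        feasible_varphi[OF nz feas] feasible_phi[OF nz feas]])

text \<open>
  The basis that diagonalizes \<open>B\<close> comes from the rotated module, where \<open>B\<close> and \<open>A\<close> trade places.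
\<close>

lemma op_pair_corresponds:
  assumes nz: "a \<noteq> 0" "b \<noteq> 0" "c \<noteq> 0" and t: "t = a * b / c" and feas: "feasible q a b c d"
    and d: "d \<ge> 1"
  shows "corresponds q scale (op_A a) (op_B b) a b c d"
proof -
  obtain v' where "evaluation_module scale q t d x2 x3 x0 x1 v'" using rotated_module by blast
  then interpret R: evaluation_module scale q t d x2 x3 x0 x1 v' .
  have "t = b * a / c" using t by (simp add: mult.commute)
  then have "\<exists>w M N. basis scale d w \<and> represents scale d w M (op_B b) \<and> represents scale d w N (op_A a) \<and>
          diagonal_mat M \<and> irred_tridiagonal N"
    using feas by (intro R.half_leonard[OF nz(2,1,3)]) (simp_all add: feasible_swap)
  then have "leonard_pair scale (op_A a) (op_B b)"
    unfolding leonard_pair_def using half_leonard[OF nz t feas] by blast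
  then show ?thesis
    unfolding corresponds_def using nz d feas split_forms[OF nz t feas] by (simp add: split_form_def)
qed

lemma op_C_completion:
  assumes nz: "a \<noteq> 0" "b \<noteq> 0" "c \<noteq> 0" and t: "t = a * b / c" and feas: "feasible q a b c d"
    and d: "d \<ge> 1"
  shows "Z3_completion q scale a b c d (op_A a) (op_B b) (op_C a b c)"
  unfolding Z3_completion_def
  using op_pair_corresponds[OF assms] linear_ops(3) Z3_equations[OF nz t] by blast

end

section \<open>The action of the algebra\<close>

lemma ring_of_type_algebra_is_ring: "ring (ring_of_type_algebra :: 'r::ring_1 ring)"
proof -
  have "\<exists>y. x + y = 0" for x :: 'r
    using add.right_inverse by blast
  then show ?thesis
    unfolding ring_of_type_algebra_def
    by unfold_locales (auto simp: algebra_simps Units_def)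
qed

lemma tet_ideal_is_ideal: "ideal (tet_ideal q) (free_tet_ring :: 'a::field free_tet ring)"
  unfolding tet_ideal_def
  by (rule ring.genideal_ideal[OF ring_of_type_algebra_is_ring]) (simp add: ring_of_type_algebra_def)

lemma tet_elt_hom: "tet_elt q \<in> Ring.ring_hom free_tet_ring (tet_algebra q)"
proof -
  have "tet_elt q = (+>\<^bsub>free_tet_ring\<^esub>) (tet_ideal q)"
    by (rule ext) (simp add: tet_elt_def)
  then show ?thesis
    unfolding tet_algebra_def by (simp only: ideal.rcos_ring_hom[OF tet_ideal_is_ideal])
qed

lemma tet_elt_relator:
  assumes "r \<in> tet_relators q"
  shows "tet_elt q r = tet_elt q 0"
proof -
  interpret ideal "tet_ideal q" "free_tet_ring :: 'a free_tet ring" by (rule tet_ideal_is_ideal)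
  have "r \<in> tet_ideal q"
    using ring.genideal_self[OF ring_of_type_algebra_is_ring, of "tet_relators q"] assms
    by (auto simp: tet_ideal_def ring_of_type_algebra_def)
  moreover have "0 \<in> tet_ideal q"
    using additive_subgroup.zero_closed[OF additive_subgroup_axioms]
    by (simp add: ring_of_type_algebra_def)
  ultimately show ?thesis by (simp add: tet_elt_def a_rcos_const)
qed

text \<open>
  The action, pulled back to noncommutative polynomials: a homomorphism that kills the relators.
\<close>

locale tet_action = coord_space scale
  for scale :: "'a::field \<Rightarrow> 'v::ab_group_add \<Rightarrow> 'v" +
  fixes q :: 'a and act :: "'a free_tet set \<Rightarrow> 'v \<Rightarrow> 'v"
  assumes tet_module: "tet_module q scale act"
begin

definition rho :: "'a free_tet \<Rightarrow> 'v \<Rightarrow> 'v" where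
  "rho p = act (tet_elt q p)"

lemma rho_hom: "rho \<in> Ring.ring_hom free_tet_ring (End_ring scale)"
proof -
  have "act \<circ> tet_elt q \<in> Ring.ring_hom free_tet_ring (End_ring scale)"
    by (rule ring_hom_trans[OF tet_elt_hom]) (use tet_module in \<open>simp add: tet_module_def\<close>)
  then show ?thesis by (simp add: rho_def[abs_def] comp_def)
qed

lemma rho_add: "rho (p + r) z = rho p z + rho r z"
  using ring_hom_add[OF rho_hom, of p r] by (simp add: ring_of_type_algebra_def End_ring_def)

lemma rho_mult: "rho (p * r) z = rho p (rho r z)"
  using ring_hom_mult[OF rho_hom, of p r] by (simp add: ring_of_type_algebra_def End_ring_def)

lemma rho_one: "rho 1 z = z"
  using ring_hom_one[OF rho_hom] by (simp add: ring_of_type_algebra_def End_ring_def)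

lemma rho_zero: "rho 0 z = 0"
  using rho_add[of 0 0 z] by simp

lemma rho_diff: "rho (p - r) z = rho p z - rho r z"
  using rho_add[of "p - r" r z] by simp

lemma rho_const: "rho (const s) z = scale s z"
  using tet_module by (simp add: rho_def tet_module_def)

lemmas rho_simps = rho_add rho_mult rho_one rho_diff rho_const

lemma rho_relator: "r \<in> tet_relators q \<Longrightarrow> rho r z = 0"
  using rho_zero[of z] by (simp add: rho_def tet_elt_relator)

lemma rho_q_weyl:
  assumes q: "q \<noteq> 0" "q\<^sup>2 \<noteq> 1" and ijk: "j - i = 1" "k - j = 1"
  shows "q_weyl q (rho (gen_x i j)) (rho (gen_x j k))"
  unfolding q_weyl_def
proof
  fix z
  let ?x = "rho (gen_x i j)" and ?y = "rho (gen_x j k)"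
  define w where "w = q - inverse q"
  have w: "w \<noteq> 0" using q by (auto simp: w_def field_simps power2_eq_square)
  have "const (1 / w) * (const q * gen_x i j * gen_x j k - const (inverse q) * gen_x j k * gen_x i j) - 1
      \<in> tet_relators q"
    unfolding w_def tet_relators_def using ijk by blast
  from rho_relator[OF this, of z]
  have "scale (1 / w) (scale q (?x (?y z)) - scale (inverse q) (?y (?x z))) = z"
    by (simp add: rho_simps)
  from arg_cong[OF this, of "scale (q * w)"]
  have "scale q (scale q (?x (?y z)) - scale (inverse q) (?y (?x z))) = scale (q * w) z"
    using w by simp
  moreover have "q * w = q\<^sup>2 - 1" using q by (simp add: w_def algebra_simps power2_eq_square)
  ultimately show "?y (?x z) = scale (q\<^sup>2) (?x (?y z)) - scale (q\<^sup>2 - 1) z"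
    using q by (simp add: scale_right_diff_distrib power2_eq_square algebra_simps)
qed

end

section \<open>The matrices\<close>

lemma Z_mat_conjugate:
  assumes M: "M \<in> carrier_mat (d + 1) (d + 1)"
  shows "Z_mat d * M * Z_mat d = mat (d + 1) (d + 1) (\<lambda>(i, j). M $$ (d - i, d - j))"
proof (rule eq_matI)
  fix i j assume "i < dim_row (mat (d + 1) (d + 1) (\<lambda>(i, j). M $$ (d - i, d - j)))"
    "j < dim_col (mat (d + 1) (d + 1) (\<lambda>(i, j). M $$ (d - i, d - j)))"
  then have ij: "i \<le> d" "j \<le> d" by auto
  have ZM: "(Z_mat d * M) $$ (i, k) = M $$ (d - i, k)" if k: "k \<le> d" for k
  proof -
    have "(Z_mat d * M) $$ (i, k) = (\<Sum>l = 0..<d + 1. (if i + l = d then 1 else 0) * M $$ (l, k))"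
      using ij k M by (simp add: Z_mat_def scalar_prod_def)
    also have "\<dots> = (\<Sum>l = 0..<d + 1. if l = d - i then M $$ (d - i, k) else 0)"
      using ij by (intro sum.cong) auto
    finally show ?thesis by simp
  qed
  have "(Z_mat d * M * Z_mat d) $$ (i, j)
      = (\<Sum>k = 0..<d + 1. (Z_mat d * M) $$ (i, k) * (if k + j = d then 1 else 0))"
    using ij M by (simp add: Z_mat_def scalar_prod_def)
  also have "\<dots> = (\<Sum>k = 0..<d + 1. if k = d - j then M $$ (d - i, d - j) else 0)"
    using ij by (intro sum.cong) (auto simp: ZM)
  finally show "(Z_mat d * M * Z_mat d) $$ (i, j)
      = mat (d + 1) (d + 1) (\<lambda>(i, j). M $$ (d - i, d - j)) $$ (i, j)"
    using ij by simp
qed (use M in \<open>auto simp: Z_mat_def\<close>)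

text \<open>
  The vanishing of \<open>hi\<close> and \<open>lo\<close> just outside the index range is what extends the formula to all integers \<open>k\<close>.
\<close>

lemma (in coord_space) represents_tridiagonal:
  assumes rep: "represents scale d v M T"
    and M: "\<And>i n. i \<le> d \<Longrightarrow> n \<le> d \<Longrightarrow> M $$ (i, n) = (if i = n then dia (int n) else if i + 1 = n then hi (int n)
        else if i = n + 1 then lo (int n) else 0)"
    and hi: "hi (int d + 1) = 0" and lo: "lo (- 1) = 0"
  shows "T (padded d v k) = scale (dia k) (padded d v k) + scale (hi k) (padded d v (k - 1))
     + scale (lo k) (padded d v (k + 1))"
proof -
  interpret T: Vector_Spaces.linear scale scale T using rep by (simp add: represents_def)
  consider n where "k = int n" "n \<le> d" | "k = int d + 1" | "k = - 1" | "k < - 1 \<or> k > int d + 1"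
    by (metis linorder_not_le nat_0_le nle_le order_le_less zle_add1_eq_le zless_imp_add1_zle
        add.commute int_one_le_iff_zero_less minus_add_cancel of_nat_le_iff)
  then show ?thesis
  proof cases
    case 1
    have pad: "scale c (padded d v (int n - 1)) = (\<Sum>i\<le>d. if i + 1 = n then scale c (v i) else 0)"
      "scale c (padded d v (int n + 1)) = (\<Sum>i\<le>d. if i = n + 1 then scale c (v i) else 0)" for c
    proof -
      show "scale c (padded d v (int n - 1)) = (\<Sum>i\<le>d. if i + 1 = n then scale c (v i) else 0)"
      proof (cases n)
        case (Suc m)
        then have "padded d v (int n - 1) = v m" using 1 by (simp add: padded_def)
        moreover have "(\<Sum>i\<le>d. if i + 1 = n then scale c (v i) else 0) = (\<Sum>i\<le>d. if i = m then scale c (v i) else 0)"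
          by (intro sum.cong) (auto simp: Suc)
        ultimately show ?thesis using 1 Suc by simp
      qed (simp add: padded_def)
      show "scale c (padded d v (int n + 1)) = (\<Sum>i\<le>d. if i = n + 1 then scale c (v i) else 0)"
        using 1 by (auto simp: padded_def nat_add_distrib)
    qed
    have "T (v n) = (\<Sum>i\<le>d. scale (M $$ (i, n)) (v i))"
      using rep 1 by (simp add: represents_def)
    also have "\<dots> = (\<Sum>i\<le>d. (if i = n then scale (dia (int n)) (v i) else 0)
        + (if i + 1 = n then scale (hi (int n)) (v i) else 0) + (if i = n + 1 then scale (lo (int n)) (v i) else 0))"
      using 1 by (intro sum.cong) (auto simp: M)
    also have "\<dots> = scale (dia (int n)) (v n) + scale (hi (int n)) (padded d v (int n - 1))
        + scale (lo (int n)) (padded d v (int n + 1))"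
      using 1 by (simp add: sum.distrib pad)
    finally show ?thesis using 1 by (simp add: padded_def[of d v "int n"])
  qed (auto simp: padded_def T.zero hi lo)
qed

text \<open>
  The matrices yield closed formulas on the padded basis, uniform in the integer \<open>k\<close>, and there the
  Casimir relations are identities between rational functions of \<open>q\<close>, \<open>t\<close>, \<open>D = q\<^bsup>d\<^esup>\<close> and \<open>Y k = q\<^bsup>k\<^esup>\<close>.
\<close>

lemma (in coord_space) matrices_give_evaluation_module:
  assumes q: "q \<noteq> 0" "\<And>n::nat. n \<ge> 1 \<Longrightarrow> q ^ n \<noteq> 1" and t: "t \<noteq> 0"
    and t_generic: "\<And>n. 1 \<le> n \<Longrightarrow> n \<le> d \<Longrightarrow> t \<noteq> q powi (int d - 2 * int n + 1)"
    and v: "basis scale d v"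
    and weyl: "q_weyl q x0 x1" "q_weyl q x1 x2" "q_weyl q x2 x3" "q_weyl q x3 x0"
    and rep0: "represents scale d v (Z_mat d * S_mat d (inverse q) (inverse t) * Z_mat d) x0"
    and rep1: "represents scale d v (E_mat d q) x1"
    and rep2: "represents scale d v (K_mat d q) x2"
    and rep3: "represents scale d v (Z_mat d * G_mat d (inverse q) t * Z_mat d) x3"
  shows "evaluation_module scale q t d x0 x1 x2 x3 v"
proof -
  have lin: "Vector_Spaces.linear scale scale x0" "Vector_Spaces.linear scale scale x1"
      "Vector_Spaces.linear scale scale x2" "Vector_Spaces.linear scale scale x3"
    using rep0 rep1 rep2 rep3 by (auto simp: represents_def)
  interpret X0: Vector_Spaces.linear scale scale x0 by fact
  interpret X1: Vector_Spaces.linear scale scale x1 by fact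
  interpret X2: Vector_Spaces.linear scale scale x2 by fact
  interpret X3: Vector_Spaces.linear scale scale x3 by fact
  define D where "D = q ^ d"
  have D: "D \<noteq> 0" using q by (simp add: D_def)
  define P where "P = padded d v"
  define Y where "Y k = q powi k" for k
  have Y: "Y k \<noteq> 0" for k using q by (simp add: Y_def)
  have Y_shift: "Y (k + 1) = q * Y k" "Y (k - 1) = Y k / q" for k
    using q by (simp_all add: Y_def power_int_add power_int_diff)
  have inv: "inverse q powi m = q powi (- m)" for m
    by (simp add: power_int_inverse power_int_minus)
  have inv_eq: "inverse q powi m = q powi m'" if "m + m' = 0" for m m'
  proof -
    have "m' = - m" using that by linarith
    then show ?thesis unfolding inv by (rule arg_cong[OF sym])
  qed
  have pw: "q powi (2 * k - int d) = (Y k)\<^sup>2 / D" "q powi (int d - 2 * k) = D / (Y k)\<^sup>2"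
    "q powi (- int d) = 1 / D" "q powi int d = D" for k
    using q by (simp_all add: power_int_diff power_int_minus power_int_double Y_def D_def divide_inverse)
  have pw1: "q powi (2 * k - int d + 1) = q * (Y k)\<^sup>2 / D" "q powi (2 * k - int d - 1) = (Y k)\<^sup>2 / (q * D)"
    "q powi (int d - 2 * k - 1) = D / (q * (Y k)\<^sup>2)" "q powi (2 * k - 2 - int d) = (Y k)\<^sup>2 / (q\<^sup>2 * D)"
    "q powi (2 * k + 2 - int d) = q\<^sup>2 * (Y k)\<^sup>2 / D" for k
    using q power_int_add[of q "2 * k - int d" 1] power_int_diff[of q "2 * k - int d" 1]
      power_int_diff[of q "int d - 2 * k" 1] power_int_diff[of q "2 * k - int d" 2]
      power_int_add[of q "2 * k - int d" 2]
    by (simp_all add: pw(1,2)[of k, unfolded mult.commute[of 2 k]] algebra_simps)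
  have P0: "x0 (P k) = scale (1 / D - ((Y k)\<^sup>2 / D - D) * (q * (Y k)\<^sup>2 / D) * inverse t
        - (1 / D - (Y k)\<^sup>2 / D) * (1 - inverse t * ((Y k)\<^sup>2 / (q * D)))) (P k)
      + scale (((Y k)\<^sup>2 / (q\<^sup>2 * D) - D) * ((Y k)\<^sup>2 / (q * D)) * inverse t) (P (k - 1))
      + scale ((1 / D - q\<^sup>2 * (Y k)\<^sup>2 / D) * (1 - inverse t * (q * (Y k)\<^sup>2 / D))) (P (k + 1))" for k
  proof -
    define dia hi lo where
      "dia k = q powi (- int d) - (q powi (2 * k - int d) - q powi int d) * q powi (2 * k - int d + 1) * inverse t
        - (q powi (- int d) - q powi (2 * k - int d)) * (1 - inverse t * q powi (2 * k - int d - 1))"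
      and "hi k = (q powi (2 * k - 2 - int d) - q powi int d) * q powi (2 * k - int d - 1) * inverse t"
      and "lo k = (q powi (- int d) - q powi (2 * k + 2 - int d)) * (1 - inverse t * q powi (2 * k - int d + 1))"
      for k
    have "x0 (P k) = scale (dia k) (P k) + scale (hi k) (P (k - 1)) + scale (lo k) (P (k + 1))"
      unfolding P_def
    proof (rule represents_tridiagonal[OF rep0])
      fix i n assume le: "i \<le> d" "n \<le> d"
      show "(Z_mat d * S_mat d (inverse q) (inverse t) * Z_mat d) $$ (i, n) =
        (if i = n then dia (int n) else if i + 1 = n then hi (int n) else if i = n + 1 then lo (int n) else 0)"
      proof -
        have conj: "(Z_mat d * S_mat d (inverse q) (inverse t) * Z_mat d) $$ (i, n) = S_mat d (inverse q) (inverse t) $$ (d - i, d - n)"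
          using le by (subst Z_mat_conjugate) (simp_all add: S_mat_def)
        consider "i = n" | "i + 1 = n" | "i = n + 1" | "i \<noteq> n" "i + 1 \<noteq> n" "i \<noteq> n + 1" by blast
        then show ?thesis
        proof cases
          case 1
          then have "S_mat d (inverse q) (inverse t) $$ (d - i, d - n) = dia (int n)"
            using le by (simp add: S_mat_def dia_def del: power_int_of_nat power_int_minus mult_cancel_right mult_cancel_left)
              (intro arg_cong2[where f = "(*)"] arg_cong2[where f = "(-)"] inv_eq refl; simp add: of_nat_diff)
          then show ?thesis using 1 conj by simp
        next
          case 2
          then have "d - i = d - n + 1" using le by simp
          then have entry: "S_mat d (inverse q) (inverse t) $$ (d - i, d - n)
              = (inverse q powi (2 * int (d - i) - int d) - inverse q powi (- int d))
                * inverse q powi (2 * int (d - i) - int d - 1) * inverse t"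
            using le by (simp add: S_mat_def)
          have "S_mat d (inverse q) (inverse t) $$ (d - i, d - n) = hi (int n)"
            unfolding entry hi_def
            by (intro arg_cong2[where f = "(*)"] arg_cong2[where f = "(-)"] inv_eq refl;
                use 2 le in \<open>simp add: of_nat_diff\<close>)
          then show ?thesis using 2 conj by simp
        next
          case 3
          then have "d - i + 1 = d - n" using le by simp
          then have "S_mat d (inverse q) (inverse t) $$ (d - i, d - n) = lo (int n)"
            using le by (simp add: S_mat_def lo_def del: power_int_of_nat power_int_minus mult_cancel_right mult_cancel_left)
              (intro arg_cong2[where f = "(*)"] arg_cong2[where f = "(-)"] inv_eq refl; simp add: of_nat_diff)
          then show ?thesis using 3 conj by simp
        next
          case 4
          then have "d - i \<noteq> d - n" "d - i + 1 \<noteq> d - n" "d - i \<noteq> d - n + 1" using le by linarith+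
          then have "S_mat d (inverse q) (inverse t) $$ (d - i, d - n) = 0"
            using le by (simp add: S_mat_def)
          then show ?thesis using 4 conj by simp
        qed
      qed
    qed (simp_all add: hi_def lo_def)
    then show ?thesis
      unfolding dia_def hi_def lo_def pw pw1 by (simp add: mult_ac)
  qed
  have P1: "x1 (P k) = scale ((Y k)\<^sup>2 / D) (P k) + scale (D - (Y k)\<^sup>2 / (q\<^sup>2 * D)) (P (k - 1))" for k
  proof -
    define dia hi lo where "dia k = q powi (2 * k - int d)" and "hi k = q powi int d - q powi (2 * k - 2 - int d)"
      and "lo k = (0::'a)" for k
    have "x1 (P k) = scale (dia k) (P k) + scale (hi k) (P (k - 1)) + scale (lo k) (P (k + 1))"
      unfolding P_def
    proof (rule represents_tridiagonal[OF rep1])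
      fix i n assume "i \<le> d" "n \<le> d"
      then show "E_mat d q $$ (i, n) =
        (if i = n then dia (int n) else if i + 1 = n then hi (int n) else if i = n + 1 then lo (int n) else 0)"
        by (auto simp: E_mat_def dia_def hi_def lo_def algebra_simps)
    qed (simp_all add: hi_def lo_def)
    then show ?thesis
      unfolding dia_def hi_def lo_def pw pw1 by (simp add: mult_ac)
  qed
  have P2: "x2 (P k) = scale (D / (Y k)\<^sup>2) (P k)" for k
  proof -
    define dia hi lo where "dia k = q powi (int d - 2 * k)" and "hi k = (0::'a)"
      and "lo k = (0::'a)" for k :: int
    have "x2 (P k) = scale (dia k) (P k) + scale (hi k) (P (k - 1)) + scale (lo k) (P (k + 1))"
      unfolding P_def
      by (rule represents_tridiagonal[OF rep2]) (auto simp: K_mat_def dia_def hi_def lo_def)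
    then show ?thesis
      unfolding dia_def hi_def lo_def pw pw1 by (simp add: mult_ac)
  qed
  have P3: "x3 (P k) = scale ((Y k)\<^sup>2 / D) (P k)
      + scale ((1 / D - q\<^sup>2 * (Y k)\<^sup>2 / D) * (1 - t * D / (q * (Y k)\<^sup>2))) (P (k + 1))" for k
  proof -
    define dia hi lo where "dia k = q powi (2 * k - int d)" and "hi k = (0::'a)"
      and "lo k = (q powi (- int d) - q powi (2 * k + 2 - int d)) * (1 - t * q powi (int d - 2 * k - 1))"
      for k
    have "x3 (P k) = scale (dia k) (P k) + scale (hi k) (P (k - 1)) + scale (lo k) (P (k + 1))"
      unfolding P_def
    proof (rule represents_tridiagonal[OF rep3])
      fix i n assume le: "i \<le> d" "n \<le> d"
      show "(Z_mat d * G_mat d (inverse q) t * Z_mat d) $$ (i, n) =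
        (if i = n then dia (int n) else if i + 1 = n then hi (int n) else if i = n + 1 then lo (int n) else 0)"
      proof -
        have conj: "(Z_mat d * G_mat d (inverse q) t * Z_mat d) $$ (i, n) = G_mat d (inverse q) t $$ (d - i, d - n)"
          using le by (subst Z_mat_conjugate) (simp_all add: G_mat_def)
        consider "i = n" | "i + 1 = n" | "i = n + 1" | "i \<noteq> n" "i + 1 \<noteq> n" "i \<noteq> n + 1" by blast
        then show ?thesis
        proof cases
          case 1
          then have "G_mat d (inverse q) t $$ (d - i, d - n) = dia (int n)"
            using le by (simp add: G_mat_def dia_def del: power_int_of_nat power_int_minus mult_cancel_right mult_cancel_left)
              (intro arg_cong2[where f = "(*)"] arg_cong2[where f = "(-)"] inv_eq refl; simp add: of_nat_diff)
          then show ?thesis using 1 conj by simp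
        next
          case 2
          then have "d - i = d - n + 1" using le by simp
          then have "G_mat d (inverse q) t $$ (d - i, d - n) = hi (int n)"
            using le by (simp add: G_mat_def hi_def del: power_int_of_nat power_int_minus mult_cancel_right mult_cancel_left)
          then show ?thesis using 2 conj by simp
        next
          case 3
          then have "d - i + 1 = d - n" using le by simp
          then have "G_mat d (inverse q) t $$ (d - i, d - n) = lo (int n)"
            using le by (simp add: G_mat_def lo_def del: power_int_of_nat power_int_minus mult_cancel_right mult_cancel_left)
              (intro arg_cong2[where f = "(*)"] arg_cong2[where f = "(-)"] inv_eq refl; simp add: of_nat_diff)
          then show ?thesis using 3 conj by simp
        next
          case 4
          then have "d - i \<noteq> d - n" "d - i + 1 \<noteq> d - n" "d - i \<noteq> d - n + 1" using le by linarith+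
          then have "G_mat d (inverse q) t $$ (d - i, d - n) = 0"
            using le by (simp add: G_mat_def)
          then show ?thesis using 4 conj by simp
        qed
      qed
    qed (simp_all add: hi_def lo_def)
    then show ?thesis
      unfolding dia_def hi_def lo_def pw pw1 by (simp add: mult_ac)
  qed
  have Pv: "P (int n) = v n" if "n \<le> d" for n using that by (simp add: P_def padded_def)
  have lin2: "Vector_Spaces.linear scale scale (\<lambda>z. x0 (x2 z))" "Vector_Spaces.linear scale scale (\<lambda>z. x2 (x0 z))"
    "Vector_Spaces.linear scale scale (\<lambda>z. x1 (x3 z))" "Vector_Spaces.linear scale scale (\<lambda>z. x3 (x1 z))"
    by (unfold_locales; simp add: X0.add X0.scale X1.add X1.scale X2.add X2.scale X3.add X3.scale)+
  define L where "L = q * D + 1 / (q * D)"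
  have lin3: "Vector_Spaces.linear scale scale (\<lambda>z. z + scale s (scale L z - scale q (x z) - scale (1 / q) (y z)))"
    if "Vector_Spaces.linear scale scale x" "Vector_Spaces.linear scale scale y" for s x y
  proof -
    interpret X: Vector_Spaces.linear scale scale x by fact
    interpret Y: Vector_Spaces.linear scale scale y by fact
    show ?thesis
      by (unfold_locales; simp add: X.add X.scale Y.add Y.scale scale_right_distrib
          scale_right_diff_distrib mult_ac)
  qed
  note compute = X0.add X0.scale X1.add X1.scale X2.add X2.scale X3.add X3.scale P0 P1 P2 P3 Y_shift
  have "x0 (x2 (P k)) = P k + scale (1 / t) (scale L (P k) - scale q (x3 (P k)) - scale (1 / q) (x1 (P k)))"
    and "x2 (x0 (P k)) = P k + scale (1 / t) (scale L (P k) - scale q (x1 (P k)) - scale (1 / q) (x3 (P k)))"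
    and "x1 (x3 (P k)) = P k + scale t (scale L (P k) - scale q (x0 (P k)) - scale (1 / q) (x2 (P k)))"
    and "x3 (x1 (P k)) = P k + scale t (scale L (P k) - scale q (x2 (P k)) - scale (1 / q) (x0 (P k)))" for k
  proof -
    show "x0 (x2 (P k)) = P k + scale (1 / t) (scale L (P k) - scale q (x3 (P k)) - scale (1 / q) (x1 (P k)))"
    proof (rule eq_if_functionals_eq[OF v])
      fix p assume lin_p: "Vector_Spaces.linear scale (*) p"
      show "p (x0 (x2 (P k))) = p (P k + scale (1 / t) (scale L (P k) - scale q (x3 (P k)) - scale (1 / q) (x1 (P k))))"
        unfolding compute functional_simps[OF lin_p] L_def diff_add_cancel add_diff_cancel using q t D Y[of k]
        by (simp add: field_simps power2_eq_square)
    qed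
    show "x2 (x0 (P k)) = P k + scale (1 / t) (scale L (P k) - scale q (x1 (P k)) - scale (1 / q) (x3 (P k)))"
    proof (rule eq_if_functionals_eq[OF v])
      fix p assume lin_p: "Vector_Spaces.linear scale (*) p"
      show "p (x2 (x0 (P k))) = p (P k + scale (1 / t) (scale L (P k) - scale q (x1 (P k)) - scale (1 / q) (x3 (P k))))"
        unfolding compute functional_simps[OF lin_p] L_def diff_add_cancel add_diff_cancel using q t D Y[of k]
        by (simp add: field_simps power2_eq_square)
    qed
    show "x1 (x3 (P k)) = P k + scale t (scale L (P k) - scale q (x0 (P k)) - scale (1 / q) (x2 (P k)))"
    proof (rule eq_if_functionals_eq[OF v])
      fix p assume lin_p: "Vector_Spaces.linear scale (*) p"
      show "p (x1 (x3 (P k))) = p (P k + scale t (scale L (P k) - scale q (x0 (P k)) - scale (1 / q) (x2 (P k))))"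
        unfolding compute functional_simps[OF lin_p] L_def diff_add_cancel add_diff_cancel using q t D Y[of k]
        by (simp add: field_simps power2_eq_square)
    qed
    show "x3 (x1 (P k)) = P k + scale t (scale L (P k) - scale q (x2 (P k)) - scale (1 / q) (x0 (P k)))"
    proof (rule eq_if_functionals_eq[OF v])
      fix p assume lin_p: "Vector_Spaces.linear scale (*) p"
      show "p (x3 (x1 (P k))) = p (P k + scale t (scale L (P k) - scale q (x2 (P k)) - scale (1 / q) (x0 (P k))))"
        unfolding compute functional_simps[OF lin_p] L_def diff_add_cancel add_diff_cancel using q t D Y[of k]
        by (simp add: field_simps power2_eq_square)
    qed
  qed
  note products_P = this
  have products: "x0 (x2 z) = z + scale (1 / t) (scale L z - scale q (x3 z) - scale (1 / q) (x1 z))"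
    "x2 (x0 z) = z + scale (1 / t) (scale L z - scale q (x1 z) - scale (1 / q) (x3 z))"
    "x1 (x3 z) = z + scale t (scale L z - scale q (x0 z) - scale (1 / q) (x2 z))"
    "x3 (x1 z) = z + scale t (scale L z - scale q (x2 z) - scale (1 / q) (x0 z))" for z
  proof -
    show "x0 (x2 z) = z + scale (1 / t) (scale L z - scale q (x3 z) - scale (1 / q) (x1 z))"
      by (rule linear_eq_on_basis[OF v lin2(1) lin3[OF lin(4,2)]]) (use products_P(1) Pv in metis)
    show "x2 (x0 z) = z + scale (1 / t) (scale L z - scale q (x1 z) - scale (1 / q) (x3 z))"
      by (rule linear_eq_on_basis[OF v lin2(2) lin3[OF lin(2,4)]]) (use products_P(2) Pv in metis)
    show "x1 (x3 z) = z + scale t (scale L z - scale q (x0 z) - scale (1 / q) (x2 z))"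
      by (rule linear_eq_on_basis[OF v lin2(3) lin3[OF lin(1,3)]]) (use products_P(3) Pv in metis)
    show "x3 (x1 z) = z + scale t (scale L z - scale q (x2 z) - scale (1 / q) (x0 z))"
      by (rule linear_eq_on_basis[OF v lin2(4) lin3[OF lin(3,1)]]) (use products_P(4) Pv in metis)
  qed
  show ?thesis
  proof (intro evaluation_module.intro evaluation_module_axioms.intro)
    show "x2 (v n) = scale (q powi (int d - 2 * int n)) (v n)" if "n \<le> d" for n
      using P2[of "int n"] Pv[OF that] q by (simp add: Y_def D_def powi_expand)
  qed (rule coord_space_axioms q(1) t lin weyl products[unfolded L_def D_def] v
      | erule q(2) | erule (1) t_generic)+
qed

section \<open>The Leonard pair and its completions\<close>

theorem theorem16p33:
  fixes q a b c t :: "'a::alg_closed_field" and d :: nat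
    and scale :: "'a \<Rightarrow> 'v \<Rightarrow> 'v::ab_group_add"
    and act :: "'a free_tet set \<Rightarrow> 'v \<Rightarrow> 'v"
    and A B C C' :: "'v \<Rightarrow> 'v"
  assumes "q \<noteq> 0" and "\<forall>n::nat. n \<ge> 1 \<longrightarrow> q ^ n \<noteq> 1"
    and "a \<noteq> 0" and "b \<noteq> 0" and "c \<noteq> 0" and "d \<ge> 1"
    and "feasible q a b c d"
    and "t = a * b * inverse c"
    and "V_module q d t scale act"
    and "A = act (tet_elt q (const a * gen_x 0 1 + const (inverse a) * gen_x 1 2))"
    and "B = act (tet_elt q (const b * gen_x 2 3 + const (inverse b) * gen_x 3 0))"
    and "C = act (tet_elt q (const c * gen_x 3 0 + const (inverse c) * gen_x 0 1
               + const (a * inverse b / (q - inverse q)) * commutator (gen_x 3 0) (gen_x 0 1)))"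
    and "C' = act (tet_elt q (const c * gen_x 1 2 + const (inverse c) * gen_x 2 3
               + const (b * inverse a / (q - inverse q)) * commutator (gen_x 1 2) (gen_x 2 3)))"
  shows "(leonard_pair scale A B \<and> q_Racah_type q scale A B)
       \<and> corresponds q scale A B a b c d
       \<and> Z3_completion q scale a b c d A B C
       \<and> dual_Z3_completion q scale a b c d A B C'"
proof -
  note nz = assms(3-5) and feas = assms(7)
  have q_root: "q ^ n \<noteq> 1" if "n \<ge> 1" for n :: nat using assms(2) that by blast
  have q2: "q\<^sup>2 \<noteq> 1" using q_root[of 2] by simp
  have module: "tet_module q scale act" using assms(9) by (simp add: V_module_def)
  interpret tet_action scale q act
    by (intro tet_action.intro coord_space.intro tet_action_axioms.intro module)
      (use module in \<open>simp add: tet_module_def\<close>)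
  let ?x = "\<lambda>i j. rho (gen_x i j)"
  obtain v where v: "basis scale d v"
    and rep: "represents scale d v (Z_mat d * S_mat d (inverse q) (inverse t) * Z_mat d) (?x 0 1)"
      "represents scale d v (E_mat d q) (?x 1 2)"
      "represents scale d v (K_mat d q) (?x 2 3)"
      "represents scale d v (Z_mat d * G_mat d (inverse q) t * Z_mat d) (?x 3 0)"
    using assms(9) by (auto simp: V_module_def Let_def rho_def)
  have weyl: "q_weyl q (?x 0 1) (?x 1 2)" "q_weyl q (?x 1 2) (?x 2 3)"
    "q_weyl q (?x 2 3) (?x 3 0)" "q_weyl q (?x 3 0) (?x 0 1)"
    by (rule rho_q_weyl[OF assms(1) q2]; simp)+
  have t: "t = a * b / c" "t = b * a / c" and t_nz: "t \<noteq> 0"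
    using assms(8) nz by (simp_all add: divide_inverse mult_ac)
  have t_generic: "t \<noteq> q powi (int d - 2 * int n + 1)" if "1 \<le> n" "n \<le> d" for n
    using feas that unfolding feasible_def assms(8) by blast
  interpret M: evaluation_module scale q t d "?x 0 1" "?x 1 2" "?x 2 3" "?x 3 0" v
    by (rule matrices_give_evaluation_module[OF assms(1) q_root t_nz t_generic v weyl rep])
  obtain v' where "evaluation_module scale q t d (?x 2 3) (?x 3 0) (?x 0 1) (?x 1 2) v'"
    using M.rotated_module by blast
  then interpret R: evaluation_module scale q t d "?x 2 3" "?x 3 0" "?x 0 1" "?x 1 2" v' .
  have A: "A = M.op_A a" and B: "B = M.op_B b"
    unfolding assms(10,11) rho_def[symmetric]
    by (auto simp: fun_eq_iff rho_simps weighted_sum_def divide_inverse)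
  have bracket: "rho (const c * x + const (inverse c) * y + const (r / (q - inverse q)) * commutator x y)
      = completion_op (r * q) c (rho x) (rho y)"
    if "q_weyl q (rho x) (rho y)" for x y r
  proof
    fix z
    have comm: "rho (commutator x y) z = scale (q\<^sup>2 - 1) (z - rho x (rho y z))"
    proof -
      have "rho y (rho x z) = scale (q\<^sup>2) (rho x (rho y z)) - scale (q\<^sup>2 - 1) z"
        using that by (simp add: q_weyl_def)
      then show ?thesis
        by (simp add: commutator_def rho_simps scale_right_diff_distrib scale_left_diff_distrib)
    qed
    have "q - inverse q \<noteq> 0" "q\<^sup>2 - 1 = q * (q - inverse q)"
      using assms(1) q2 by (auto simp: field_simps power2_eq_square)
    then have "r / (q - inverse q) * (q\<^sup>2 - 1) = r * q" by simp
    then show "rho (const c * x + const (inverse c) * y + const (r / (q - inverse q)) * commutator x y) z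
      = completion_op (r * q) c (rho x) (rho y) z"
      by (simp add: rho_simps comm completion_op_def divide_inverse)
  qed
  have C: "C = M.op_C a b c"
    using bracket[OF weyl(4), of "a * inverse b"]
    unfolding assms(12) rho_def[symmetric] by (simp add: divide_inverse mult_ac)
  have C': "C' = R.op_C b a c"
    using bracket[OF weyl(2), of "b * inverse a"]
    unfolding assms(13) rho_def[symmetric] by (simp add: divide_inverse mult_ac)
  have completion: "Z3_completion q scale a b c d A B C"
    unfolding A B C by (rule M.op_C_completion[OF nz t(1) feas assms(6)])
  have "feasible q b a c d" using feas feasible_swap by blast
  then have "Z3_completion q scale b a c d B A C'"
    unfolding A B C' using R.op_C_completion[OF nz(2,1,3) t(2) _ assms(6)] by blast
  then have "dual_Z3_completion q scale a b c d A B C'" by (simp add: dual_Z3_completion_def)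
  moreover have "corresponds q scale A B a b c d"
    using completion by (simp add: Z3_completion_def)
  moreover from this have "q_Racah_type q scale A B" unfolding q_Racah_type_def by blast
  moreover have "leonard_pair scale A B" using \<open>corresponds q scale A B a b c d\<close> by (simp add: corresponds_def)
  ultimately show ?thesis using completion by blast
qed

end
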